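(* Let $c,b_0,b_1,a_0,a_1\in\mathbb{R}$ with $c\,a_1 b_1\le 0$ and $c\,a_1\neq 0$, and let $B(z)=b_0+b_1z$, $A(z)=a_0+a_1z$. Define polynomials $P_m(z)$, $m\ge 0$, by $$\sum_{m=0}^\infty P_m(z)t^m=\frac{1}{1+ct+B(z)t^2+A(z)t^3}.$$ Put $a:=\dfrac{b_0}{c^2}-\dfrac{b_1a_0}{c^2a_1}$ and $b:=-\dfrac{b_1c}{a_1}$. Then all zeros of $P_m(z)$ are real for every $m\in\mathbb{N}$ if and only if $$1+a+b\ge 0\qquad\text{and}\qquad 9-27a+b\ge 0.$$
   Context: Equivalently, $P_0\equiv 1$, $P_{-k}\equiv 0$ for $k\ge1$, and $P_m(z)+cP_{m-1}(z)+B(z)P_{m-2}(z)+A(z)P_{m-3}(z)=0$ for $m\ge1$. *)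

theory Defs
  imports "HOL-Computational_Algebra.Polynomial" Complex_Main
begin

text \<open>The polynomials P_m defined by the generating function
  sum P_m(z) t^m = 1/(1 + c t + B(z) t^2 + A(z) t^3), equivalently
  P_0 = 1, P_{-k} = 0, P_m + c P_{m-1} + B P_{m-2} + A P_{m-3} = 0.\<close>
fun Pseq :: "real \<Rightarrow> real poly \<Rightarrow> real poly \<Rightarrow> nat \<Rightarrow> real poly" where
  "Pseq c B A 0 = 1"
| "Pseq c B A (Suc 0) = - smult c (Pseq c B A 0)"
| "Pseq c B A (Suc (Suc 0)) = - smult c (Pseq c B A (Suc 0)) - B * Pseq c B A 0"
| "Pseq c B A (Suc (Suc (Suc n))) =
     - smult c (Pseq c B A (Suc (Suc n))) - B * Pseq c B A (Suc n) - A * Pseq c B A n"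

definition all_zeros_real :: "real poly \<Rightarrow> bool" where
  "all_zeros_real p \<longleftrightarrow> (\<forall>z::complex. poly (map_poly complex_of_real p) z = 0 \<longrightarrow> z \<in> \<real>)"

end

theory Submission
  imports Defs "HOL-Complex_Analysis.Complex_Analysis" "HOL-Real_Asymp.Real_Asymp"
begin

text \<open>
  Scaling \<open>t\<close> and substituting \<open>w = A(z) / c\<^sup>3\<close> reduces the problem to the polynomials \<open>h\<^sub>m(x, y, s)\<close>
  (complete homogeneous symmetric) in the roots \<open>x, y, s\<close> of \<open>X\<^sup>3 + X\<^sup>2 + (a - b w) X + w\<close>, where \<open>b \<ge> 0\<close>.

  Sufficiency: the two inequalities say that for some \<open>r\<^sub>0 \<in> [1/3, 1]\<close> the cubic has the double root \<open>- r\<^sub>0\<close>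
  at a suitable real \<open>w\<close>. From there a curve \<open>r > r\<^sub>0\<close> starts along which \<open>w\<close> is real and the roots are
  \<open>- r e\<^sup>\<plusminus>\<^sup>i\<^sup>\<phi>\<close> and a real \<open>s\<close> with \<open>\<bar>s\<bar> < r\<close>. At \<open>\<phi> = j \<pi> / (m + 2)\<close> the value of \<open>h\<^sub>m\<close>
  is, up to a positive factor, \<open>s\<^bsup>m+2\<^esup> - (- 1)\<^sup>j (- r)\<^bsup>m+2\<^esup>\<close>, so its sign alternates with \<open>j\<close>. This yields all real
  zeros but at most one, and the last one is real because nonreal zeros come in pairs.

  Necessity: given \<open>s\<close>, the other two roots satisfy \<open>(x + y)\<^sup>2 / (x y) = K(s)\<close> with \<open>K\<close> rational. If an inequality
  fails, \<open>K\<close> has a local maximum on the real line, with value in \<open>[0, 4)\<close>, at which \<open>\<bar>s\<bar>\<^sup>2 < \<bar>x y\<bar>\<close>; by the open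
  mapping theorem some nonreal \<open>s\<close> nearby has \<open>K(s) \<in> (0, 4)\<close>, that is, \<open>\<bar>x\<bar> = \<bar>y\<bar> > \<bar>s\<bar>\<close>. Near such a
  point zeros of \<open>h\<^sub>m\<close> must accumulate.
\<close>

section \<open>Complete homogeneous symmetric polynomials of three roots\<close>

text \<open>The complete homogeneous symmetric polynomial of degree \<open>n\<close> in three
  variables, written in their elementary symmetric functions. In this form no roots have to be
  chosen, and real and complex arguments share one definition.\<close>

fun hrec :: "'a::comm_ring_1 \<Rightarrow> 'a \<Rightarrow> 'a \<Rightarrow> nat \<Rightarrow> 'a" where
  "hrec e1 e2 e3 0 = 1"
| "hrec e1 e2 e3 (Suc 0) = e1"
| "hrec e1 e2 e3 (Suc (Suc 0)) = e1\<^sup>2 - e2"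
| "hrec e1 e2 e3 (Suc (Suc (Suc n))) =
     e1 * hrec e1 e2 e3 (Suc (Suc n)) - e2 * hrec e1 e2 e3 (Suc n) + e3 * hrec e1 e2 e3 n"

lemma nat_induct3 [case_names 1 2 3 4]:
  assumes "P 0" "P (Suc 0)" "P (Suc (Suc 0))"
    and "\<And>n. P (Suc (Suc n)) \<Longrightarrow> P (Suc n) \<Longrightarrow> P n \<Longrightarrow> P (Suc (Suc (Suc n)))"
  shows "P n"
  using assms by induction_schema (pat_completeness, lexicographic_order)

lemma map_poly_of_real_add:
  "map_poly complex_of_real (p + q) = map_poly of_real p + map_poly of_real q"
  by (intro poly_eqI) (simp add: coeff_map_poly)

lemma map_poly_of_real_diff:
  "map_poly complex_of_real (p - q) = map_poly of_real p - map_poly of_real q"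
  by (intro poly_eqI) (simp add: coeff_map_poly)

lemma map_poly_of_real_minus:
  "map_poly complex_of_real (- p) = - map_poly of_real p"
  by (intro poly_eqI) (simp add: coeff_map_poly)

lemma map_poly_of_real_mult:
  "map_poly complex_of_real (p * q) = map_poly of_real p * map_poly of_real q"
  by (intro poly_eqI) (simp add: coeff_map_poly coeff_mult)

lemmas map_poly_of_real_simps =
  map_poly_of_real_add map_poly_of_real_diff map_poly_of_real_minus map_poly_of_real_mult

text \<open>If \<open>1 + c t + B t^2 + A t^3\<close> is factored into terms \<open>1 - x t\<close>,
  the three \<open>x\<close> have the elementary symmetric functions \<open>- c\<close>,
  \<open>B\<close>, \<open>- A\<close>.\<close>

lemma poly_Pseq:
  "poly (Pseq c B A n) x = hrec (- c) (poly B x) (- poly A x) n"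
  by (induction "- c" "poly B x" "- poly A x" n rule: hrec.induct)
     (auto simp: power2_eq_square algebra_simps)

lemma poly_map_Pseq:
  "poly (map_poly complex_of_real (Pseq c B A n)) z =
   hrec (- of_real c) (poly (map_poly of_real B) z) (- poly (map_poly of_real A) z) n"
  by (induction n rule: nat_induct3)
     (auto simp: power2_eq_square algebra_simps map_poly_of_real_simps map_poly_smult map_poly_pCons)

text \<open>Homogeneity: all three roots are multiplied by \<open>c\<close>.\<close>

lemma hrec_scale:
  "hrec (c * e1) (c\<^sup>2 * e2) (c ^ 3 * e3) n = c ^ n * hrec e1 e2 e3 n"
  by (induction e1 e2 e3 n rule: hrec.induct)
     (auto simp: power2_eq_square power3_eq_cube algebra_simps)

lemma of_real_hrec:
  "hrec (complex_of_real e1) (of_real e2) (of_real e3) n = of_real (hrec e1 e2 e3 n)"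
  by (induction e1 e2 e3 n rule: hrec.induct) auto

text \<open>The factor \<open>B\<close> raises the degree by one at the cost of two index steps, the
  factor \<open>A\<close> at the cost of three.\<close>

lemma degree_Pseq: "degree (Pseq 1 [:a, - b:] [:0, 1:] n) \<le> n div 2"
proof (induction n rule: nat_induct3)
  case (4 n)
  have "degree ([:a, - b:] * Pseq 1 [:a, - b:] [:0, 1:] (Suc n)) \<le> 1 + Suc n div 2"
    using 4 by (intro order.trans[OF degree_mult_le] add_mono) auto
  moreover have "degree ([:0, 1:] * Pseq 1 [:a, - b:] [:0, 1:] n) \<le> 1 + n div 2"
    using 4 by (intro order.trans[OF degree_mult_le] add_mono) auto
  ultimately show ?case using 4
    by (simp only: Pseq.simps smult_1_left, intro degree_diff_le) auto
qed auto

text \<open>With constant \<open>B\<close> only \<open>A\<close> raises the degree. The sharper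
  bound matters because for \<open>b = 0\<close> only angles below \<open>pi / 3\<close> will be
  available as nodes.\<close>

lemma degree_Pseq_zero: "degree (Pseq 1 [:a, 0:] [:0, 1:] n) \<le> n div 3"
proof (induction n rule: nat_induct3)
  case (4 n)
  have "degree ([:a, 0:] * Pseq 1 [:a, 0:] [:0, 1:] (Suc n)) \<le> 0 + Suc n div 3"
    using 4 by (intro order.trans[OF degree_mult_le] add_mono) auto
  moreover have "degree ([:0, 1:] * Pseq 1 [:a, 0:] [:0, 1:] n) \<le> 1 + n div 3"
    using 4 by (intro order.trans[OF degree_mult_le] add_mono) auto
  ultimately show ?case using 4
    by (simp only: Pseq.simps smult_1_left, intro degree_diff_le) auto
qed auto

text \<open>The bialternant formula. Both sides satisfy the same third-order recurrence, since the
  powers of each root do, and three initial values agree.\<close>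

lemma hrec_roots:
  fixes x y z :: "'a::comm_ring_1"
  shows "(x - y) * ((z - x) * (z - y)) * hrec (x + y + z) (x * y + x * z + y * z) (x * y * z) n =
    (x - y) * z ^ (n + 2) + (z - x) * y ^ (n + 2) - (z - y) * x ^ (n + 2)"
proof (induction n rule: nat_induct3)
  case (4 n)
  let ?V = "(x - y) * ((z - x) * (z - y))"
  let ?h = "hrec (x + y + z) (x * y + x * z + y * z) (x * y * z)"
  have "?V * ?h (Suc (Suc (Suc n))) = (x + y + z) * (?V * ?h (Suc (Suc n)))
     - (x * y + x * z + y * z) * (?V * ?h (Suc n)) + (x * y * z) * (?V * ?h n)"
    by (simp add: algebra_simps)
  also have "\<dots> = (x - y) * z ^ (Suc (Suc (Suc n)) + 2) + (z - x) * y ^ (Suc (Suc (Suc n)) + 2)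
       - (z - y) * x ^ (Suc (Suc (Suc n)) + 2)"
    unfolding 4 by (simp add: algebra_simps)
  finally show ?case .
qed (simp_all add: algebra_simps power2_eq_square power3_eq_cube numeral_eq_Suc)

definition hsym2 :: "'a::comm_ring_1 \<Rightarrow> 'a \<Rightarrow> nat \<Rightarrow> 'a" where
  "hsym2 y z n = (\<Sum>i\<le>n. y ^ i * z ^ (n - i))"

lemma hsym2_Suc: "hsym2 y z (Suc n) = z * hsym2 y z n + y ^ Suc n"
proof -
  have "(\<Sum>i\<le>n. y ^ i * z ^ (Suc n - i)) = z * (\<Sum>i\<le>n. y ^ i * z ^ (n - i))"
    by (auto simp: sum_distrib_left Suc_diff_le intro!: sum.cong)
  thus ?thesis by (simp add: hsym2_def)
qed

text \<open>Monomials are sorted by whether they contain \<open>x\<close>; those that do not form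
  the two-variable polynomial \<open>hsym2\<close>. Unlike the bialternant formula this stays
  informative when roots coincide.\<close>

lemma hrec_Suc_roots:
  fixes x y z :: "'a::comm_ring_1"
  defines "h \<equiv> hrec (x + y + z) (x * y + x * z + y * z) (x * y * z)"
  shows "h (Suc n) = x * h n + hsym2 y z (Suc n)"
proof (induction n rule: nat_induct3)
  case (4 n)
  have 0: "hsym2 y z (Suc n) = h (Suc n) - x * h n" using 4 by simp
  have 1: "hsym2 y z (Suc (Suc n)) = h (Suc (Suc n)) - x * h (Suc n)" using 4 by simp
  have 2: "hsym2 y z (Suc (Suc (Suc n))) = h (Suc (Suc (Suc n))) - x * h (Suc (Suc n))"
    using 4 by simp
  have "hsym2 y z (Suc (Suc (Suc (Suc n)))) = z * hsym2 y z (Suc (Suc (Suc n))) +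
    y * y ^ Suc (Suc (Suc n))"
    by (simp only: hsym2_Suc[of y z "Suc (Suc (Suc n))"] power_Suc)
  also have "y ^ Suc (Suc (Suc n)) = hsym2 y z (Suc (Suc (Suc n))) - z * hsym2 y z (Suc (Suc n))"
    using hsym2_Suc[of y z "Suc (Suc n)"] by simp
  finally have "hsym2 y z (Suc (Suc (Suc (Suc n)))) =
    (y + z) * hsym2 y z (Suc (Suc (Suc n))) - y * z * hsym2 y z (Suc (Suc n))"
    by (simp add: algebra_simps)
  thus ?case unfolding 1 2 by (simp add: h_def algebra_simps)
qed (simp_all add: h_def hsym2_Suc hsym2_def[of _ _ 0] algebra_simps power2_eq_square)

text \<open>There are \<open>(n + 1) (n + 2) / 2\<close> monomials, each of modulus at most
  \<open>M ^ n\<close>. The cruder factor suffices, since its \<open>n\<close>-th root still tends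
  to 1.\<close>

lemma norm_hrec_le:
  fixes x y z :: complex
  assumes "norm x \<le> M" "norm y \<le> M" "norm z \<le> M"
  shows "norm (hrec (x + y + z) (x * y + x * z + y * z) (x * y * z) n) \<le> (real n + 1)\<^sup>2 * M ^ n"
proof (induction n)
  case (Suc n)
  have M: "M \<ge> 0" using assms(1) norm_ge_zero order.trans by blast
  have T: "norm (hsym2 y z (Suc n)) \<le> (\<Sum>i\<le>Suc n. M ^ Suc n)"
    unfolding hsym2_def
  proof (rule sum_norm_le)
    fix i assume "i \<in> {..Suc n}"
    have "norm (y ^ i * z ^ (Suc n - i)) \<le> M ^ i * M ^ (Suc n - i)"
      using assms M by (auto simp: norm_mult norm_power intro!: mult_mono power_mono)
    also have "\<dots> = M ^ Suc n" using \<open>i \<in> _\<close> by (simp flip: power_add)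
    finally show "norm (y ^ i * z ^ (Suc n - i)) \<le> M ^ Suc n" .
  qed
  have "norm (hrec (x + y + z) (x * y + x * z + y * z) (x * y * z) (Suc n)) \<le>
    norm x * norm (hrec (x + y + z) (x * y + x * z + y * z) (x * y * z) n) + norm (hsym2 y z (Suc n))"
    unfolding hrec_Suc_roots by (metis norm_mult norm_triangle_ineq)
  also have "\<dots> \<le> M * ((real n + 1)\<^sup>2 * M ^ n) + (\<Sum>i\<le>Suc n. M ^ Suc n)"
    by (intro add_mono mult_mono assms Suc.IH T M norm_ge_zero)
  also have "\<dots> = ((real n + 1)\<^sup>2 + (real n + 2)) * M ^ Suc n" by (simp add: algebra_simps)
  also have "\<dots> \<le> (real (Suc n) + 1)\<^sup>2 * M ^ Suc n"
    using M by (intro mult_right_mono) (auto simp: power2_eq_square algebra_simps)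
  finally show ?case by simp
qed simp

text \<open>After division by \<open>x ^ n\<close> the polynomial is a partial sum of the Cauchy
  product of the geometric series in \<open>y / x\<close> and \<open>z / x\<close>.\<close>

lemma hrec_dominant_limit:
  fixes x y z :: complex
  assumes "norm y < norm x" "norm z < norm x"
  shows "(\<lambda>n. hrec (x + y + z) (x * y + x * z + y * z) (x * y * z) n / x ^ n)
           \<longlonglongrightarrow> 1 / ((1 - y / x) * (1 - z / x))"
proof -
  have x: "x \<noteq> 0" using assms by auto
  have eq: "hrec (x + y + z) (x * y + x * z + y * z) (x * y * z) n / x ^ n =
    (\<Sum>k\<le>n. \<Sum>i\<le>k. (y / x) ^ i * (z / x) ^ (k - i))" for n
  proof (induction n)
    case (Suc n)
    have "hsym2 y z (Suc n) / x ^ Suc n = (\<Sum>i\<le>Suc n. (y / x) ^ i * (z / x) ^ (Suc n - i))"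
      unfolding hsym2_def sum_divide_distrib
      using x by (intro sum.cong) (auto simp: power_divide simp flip: power_add)
    thus ?case using x Suc
      by (simp only: hrec_Suc_roots sum.atMost_Suc[of _ n] add_divide_distrib) simp
  qed simp
  have "(\<lambda>k. \<Sum>i\<le>k. (y / x) ^ i * (z / x) ^ (k - i)) sums ((\<Sum>k. (y / x) ^ k) * (\<Sum>k. (z / x) ^ k))"
    using assms x by (intro Cauchy_product_sums)
      (auto simp: norm_power norm_divide intro!: summable_geometric)
  also have "(\<Sum>k. (y / x) ^ k) * (\<Sum>k. (z / x) ^ k) = 1 / ((1 - y / x) * (1 - z / x))"
    using assms x by (subst (1 2) suminf_geometric) (auto simp: norm_divide)
  finally show ?thesis unfolding eq sums_def_le .
qed

lemma all_zeros_real_degree_le_1: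
  assumes "p \<noteq> 0" "degree p \<le> 1"
  shows "all_zeros_real p"
  unfolding all_zeros_real_def
proof (intro allI impI)
  fix z assume z: "poly (map_poly complex_of_real p) z = 0"
  define u v where "u = coeff p 0" and "v = coeff p 1"
  have p: "p = [:u, v:]"
    using assms(2) by (intro poly_eqI)
      (auto simp: u_def v_def coeff_pCons coeff_eq_0 split: nat.splits)
  have uv: "of_real u + z * of_real v = 0" using z by (simp add: p map_poly_pCons)
  have "v \<noteq> 0" using uv assms(1) by (auto simp: p)
  hence "z = of_real (- u / v)" using uv by (auto simp: field_simps add_eq_0_iff)
  thus "z \<in> \<real>" by (metis Reals_of_real)
qed

text \<open>Dividing out the known real roots leaves a real polynomial of degree at most one, so one
  zero may stay uncounted.\<close>

lemma all_zeros_real_if_roots: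
  fixes p :: "real poly"
  assumes "finite S" "\<And>x. x \<in> S \<Longrightarrow> poly p x = 0" "p \<noteq> 0" "degree p \<le> card S + 1"
  shows "all_zeros_real p"
  using assms
proof (induction S arbitrary: p rule: finite_induct)
  case empty
  thus ?case by (intro all_zeros_real_degree_le_1) auto
next
  case (insert s S)
  from insert.prems(1)[of s] obtain q where p: "p = [:- s, 1:] * q"
    by (auto simp: poly_eq_0_iff_dvd)
  have q0: "q \<noteq> 0" using insert.prems(2) p by auto
  have "poly q x = 0" if "x \<in> S" for x
    using insert.prems(1)[of x] insert.hyps(2) that by (auto simp: p)
  moreover have "degree q \<le> card S + 1"
    using insert.prems(3) insert.hyps q0 by (simp add: p degree_mult_eq del: mult_pCons_left)
  ultimately have "all_zeros_real q" using insert.IH q0 by blast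
  thus ?case by (auto simp: all_zeros_real_def p map_poly_of_real_mult map_poly_pCons
      simp del: mult_pCons_left)
qed

subsection \<open>Counting real zeros\<close>

text \<open>As \<open>f\<close> need not be monotone, the points are picked one at a time: at the
  last point \<open>f\<close> still exceeds the next level, and the intermediate value theorem is
  applied to its right.\<close>

lemma decreasing_hits:
  fixes f c :: "_ \<Rightarrow> real"
  assumes "continuous_on {r0..} f"
    and "\<And>i. i < n \<Longrightarrow> c i < f r0"
    and "\<And>i j. i < j \<Longrightarrow> j < n \<Longrightarrow> c j < c i"
    and "\<And>i N. i < n \<Longrightarrow> \<exists>r\<ge>N. f r \<le> c i"
  shows "\<exists>\<rho>. \<forall>i<n. r0 < \<rho> i \<and> f (\<rho> i) = c (i::nat) \<and> (\<forall>j<i. \<rho> j < (\<rho> i :: real))"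
  using assms
proof (induction n)
  case (Suc n)
  have "\<exists>\<rho>. \<forall>i<n. r0 < \<rho> i \<and> f (\<rho> i) = c i \<and> (\<forall>j<i. \<rho> j < \<rho> i)"
    by (rule Suc.IH) (use Suc.prems in auto)
  then obtain \<rho> where \<rho>: "\<And>i. i < n \<Longrightarrow> r0 < \<rho> i \<and> f (\<rho> i) = c i \<and> (\<forall>j<i. \<rho> j < \<rho> i)"
    by blast
  \<comment> \<open>The first point has no predecessor; its search starts at
    \<open>r0\<close>.\<close>
  define p where "p = (if n = 0 then r0 else \<rho> (n - 1))"
  have p: "r0 \<le> p" "c n < f p"
    using \<rho>[of "n - 1"] Suc.prems(2)[of n] Suc.prems(3)[of "n - 1" n] by (auto simp: p_def)
  obtain r where r: "r \<ge> p" "f r \<le> c n" using Suc.prems(4)[of n p] by auto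
  have "continuous_on {p..r} f"
    using p by (intro continuous_on_subset[OF Suc.prems(1)]) auto
  then obtain x where x: "p \<le> x" "f x = c n"
    using IVT2'[of f r "c n" p] r p by auto
  hence px: "p < x" using p by (metis less_irrefl order_le_less)
  have "\<rho> j < x" if "j < n" for j
  proof -
    have "p = \<rho> (n - 1)" using that by (simp add: p_def)
    moreover have "j = n - 1 \<or> j < n - 1" using that by linarith
    ultimately show ?thesis using \<rho>[of "n - 1"] that px by force
  qed
  hence "\<forall>i<Suc n. r0 < (\<rho>(n := x)) i \<and> f ((\<rho>(n := x)) i) = c i \<and>
           (\<forall>j<i. (\<rho>(n := x)) j < (\<rho>(n := x)) i)"
    using \<rho> x px p by (auto simp: less_Suc_eq)
  thus ?case by blast
qed simp

text \<open>The factor \<open>\<epsilon>\<close> absorbs a sign common to all points; it will be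
  \<open>(- 1) ^ m\<close>.\<close>

lemma zeros_of_sign_changes:
  fixes F \<rho> :: "_ \<Rightarrow> real"
  assumes "continuous_on {r0<..} F"
    and \<rho>: "\<And>i. i < n \<Longrightarrow> r0 < \<rho> i" "\<And>i j. i < j \<Longrightarrow> j < n \<Longrightarrow> \<rho> j > \<rho> (i::nat)"
    and sgn: "\<And>i. i < n \<Longrightarrow> 0 < (- 1) ^ i * \<epsilon> * F (\<rho> i)"
  shows "\<exists>Z. finite Z \<and> card Z = n - 1 \<and> Z \<subseteq> {r0<..} \<and> (\<forall>z\<in>Z. F z = 0)"
proof -
  have "\<exists>z. \<rho> i < z \<and> z < \<rho> (Suc i) \<and> F z = 0" if i: "Suc i < n" for i
  proof -
    have lt: "r0 < \<rho> i" "\<rho> i < \<rho> (Suc i)" using \<rho> i by auto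
    have c: "continuous_on {\<rho> i..\<rho> (Suc i)} F"
      using lt by (intro continuous_on_subset[OF assms(1)]) auto
    have "0 < (- 1) ^ i * \<epsilon> * F (\<rho> i)" "0 < - ((- 1) ^ i * \<epsilon> * F (\<rho> (Suc i)))"
      using sgn[of i] sgn[of "Suc i"] i by auto
    hence "(F (\<rho> i) < 0 \<and> 0 < F (\<rho> (Suc i))) \<or> (0 < F (\<rho> i) \<and> F (\<rho> (Suc i)) < 0)"
      by (cases "0 < (- 1) ^ i * \<epsilon>") (auto simp: zero_less_mult_iff mult_less_0_iff)
    hence "\<exists>z. \<rho> i \<le> z \<and> z \<le> \<rho> (Suc i) \<and> F z = 0 \<and> F (\<rho> i) \<noteq> 0 \<and> F (\<rho> (Suc i)) \<noteq> 0"
      using IVT'[of F "\<rho> i" 0 "\<rho> (Suc i)"] IVT2'[of F "\<rho> (Suc i)" 0 "\<rho> i"] c lt by fastforce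
    thus ?thesis by (metis order_le_less)
  qed
  then obtain z where z: "\<And>i. Suc i < n \<Longrightarrow> \<rho> i < z i \<and> z i < \<rho> (Suc i) \<and> F (z i) = 0"
    by metis
  have less: "z i < z j" if "i < j" "Suc j < n" for i j
  proof -
    have "\<rho> (Suc i) \<le> \<rho> j" using \<rho>(2)[of "Suc i" j] that by (cases "Suc i = j") auto
    thus ?thesis using z[of i] z[of j] that by auto
  qed
  have "inj_on z {..<n - 1}"
  proof (rule inj_onI)
    fix i j assume "i \<in> {..<n - 1}" "j \<in> {..<n - 1}" "z i = z j"
    thus "i = j" using less[of i j] less[of j i] by (cases i j rule: linorder_cases) (auto simp: less_diff_conv)
  qed
  hence "card (z ` {..<n - 1}) = n - 1" by (simp add: card_image)
  moreover have "z ` {..<n - 1} \<subseteq> {r0<..}"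
  proof
    fix x assume "x \<in> z ` {..<n - 1}"
    then obtain i where "Suc i < n" "x = z i" by (auto simp: less_diff_conv)
    thus "x \<in> {r0<..}" using z[of i] \<rho>(1)[of i] by auto
  qed
  ultimately show ?thesis using z
    by (intro exI[of _ "z ` {..<n - 1}"]) (auto simp: less_diff_conv)
qed

text \<open>At such an angle the conjugate roots \<open>x\<close>, \<open>y\<close> of modulus
  \<open>r\<close> have the same real \<open>(m + 2)\<close>-th power \<open>E\<close>, so the
  bialternant formula loses its factor \<open>x - y\<close> and becomes
  \<open>D * H = s ^ N - E\<close>. Since \<open>\<bar>s\<bar> < r\<close>, the sign is decided by
  \<open>E\<close>.\<close>

lemma hrec_at_node:
  fixes r s \<phi> w a b :: real
  assumes a: "a - b * w = r\<^sup>2 - s * (1 + s)" and w: "w = - r\<^sup>2 * s"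
    and s: "\<bar>s\<bar> < r" "1 + s = 2 * r * cos \<phi>"
    and \<phi>: "0 < \<phi>" "\<phi> < pi" "real (m + 2) * \<phi> = real (Suc i) * pi"
  shows "0 < (- 1) ^ i * (- 1) ^ m * hrec (- 1) (a - b * w) (- w) m"
proof -
  define x y where "x = - of_real r * cis \<phi>" and "y = - of_real r * cis (- \<phi>)"
  define z where "z = complex_of_real s"
  define N where "N = m + 2"
  define E where "E = (- r) ^ N * (- 1) ^ Suc i"
  define H where "H = hrec (- 1) (a - b * w) (- w) m"
  \<comment> \<open>\<open>D\<close> is \<open>(s - x) (s - y)\<close>, which is positive because
    \<open>x\<close> and \<open>y\<close> are nonreal conjugates.\<close>
  define D where "D = s\<^sup>2 + (1 + s) * s + r\<^sup>2"
  have r: "r > 0" using s by linarith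
  have xy_sum: "x + y = of_real (- (1 + s))"
    unfolding s(2) by (simp add: x_def y_def complex_eq_iff)
  have xy_prod: "x * y = of_real (r\<^sup>2)"
    by (simp add: x_def y_def cis_mult power2_eq_square)
  have "cis (real N * \<phi>) = cis pi ^ Suc i"
    unfolding N_def \<phi>(3) by (rule Complex.DeMoivre[symmetric])
  hence pow: "cis (real N * \<phi>) = (- 1) ^ Suc i" by simp
  have pow': "cis (- (real N * \<phi>)) = (- 1) ^ Suc i"
    unfolding cis_inverse[symmetric] pow by (simp flip: power_inverse)
  have xN: "x ^ N = of_real E" "y ^ N = of_real E"
    using pow pow' unfolding x_def y_def power_mult_distrib Complex.DeMoivre E_def by auto
  have "x \<noteq> y"
    using r sin_gt_zero[OF \<phi>(1,2)] by (auto simp: x_def y_def complex_eq_iff)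
  have e1: "x + y + z = of_real (- 1)" using xy_sum by (simp add: z_def)
  have "x * y + x * z + y * z = x * y + (x + y) * z" by (simp add: algebra_simps)
  also have "\<dots> = of_real (a - b * w)"
    unfolding xy_sum xy_prod z_def a by (simp add: algebra_simps)
  finally have e2: "x * y + x * z + y * z = of_real (a - b * w)" .
  have e3: "x * y * z = of_real (- w)" unfolding xy_prod z_def w by simp
  have "(x - y) * ((z - x) * (z - y) * of_real H) =
          (x - y) * z ^ N + (z - x) * y ^ N - (z - y) * x ^ N"
    using hrec_roots[of x y z m] unfolding e1 e2 e3 of_real_hrec H_def N_def
    by (simp only: mult.assoc)
  also have "\<dots> = (x - y) * (z ^ N - of_real E)"
    unfolding xN by (simp add: algebra_simps)
  finally have "(z - x) * (z - y) * of_real H = z ^ N - of_real E"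
    using \<open>x \<noteq> y\<close> by simp
  moreover have "(z - x) * (z - y) = of_real D"
  proof -
    have "(z - x) * (z - y) = z\<^sup>2 - (x + y) * z + x * y"
      by (simp add: algebra_simps power2_eq_square)
    thus ?thesis unfolding xy_sum xy_prod D_def z_def by (simp add: algebra_simps)
  qed
  ultimately have "complex_of_real (D * H) = of_real (s ^ N - E)" by (simp add: z_def)
  hence DH: "D * H = s ^ N - E" by (simp only: of_real_eq_iff)
  have "(- 1) ^ i * (- 1) ^ m * E = - (r ^ N) * ((- 1) ^ i * (- 1) ^ i) * ((- 1) ^ m * (- 1) ^ m)"
    by (simp add: E_def N_def power_minus[of r])
  hence E: "(- 1) ^ i * (- 1) ^ m * E = - (r ^ N)"
    by (simp flip: power_add add: mult_2[symmetric])
  have "\<bar>(- 1) ^ i * (- 1) ^ m * s ^ N\<bar> = \<bar>s\<bar> ^ N" by (simp add: abs_mult power_abs)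
  also have "\<dots> < r ^ N" using s by (intro power_strict_mono) (auto simp: N_def)
  finally have "0 < (- 1) ^ i * (- 1) ^ m * (D * H)"
    unfolding DH right_diff_distrib E by linarith
  moreover have "D > 0"
  proof -
    have "D = (s + (1 + s) / 2)\<^sup>2 + (r\<^sup>2 - ((1 + s) / 2)\<^sup>2)"
      by (simp add: D_def power2_eq_square algebra_simps)
    moreover have "r\<^sup>2 - ((1 + s) / 2)\<^sup>2 = r\<^sup>2 * (sin \<phi>)\<^sup>2"
      by (simp add: s(2) power_mult_distrib sin_squared_eq algebra_simps)
    moreover have "r\<^sup>2 * (sin \<phi>)\<^sup>2 > 0" using r sin_gt_zero[OF \<phi>(1,2)] by simp
    ultimately show ?thesis by (smt (verit) zero_le_power2)
  qed
  ultimately show ?thesis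
    by (metis H_def mult.left_commute zero_less_mult_pos)
qed

section \<open>The curve of conjugate root pairs that starts at a double root\<close>

text \<open>A cubic of the family with double root \<open>- r0\<close> must have third root
  \<open>2 r0 - 1\<close> and \<open>w = - r0^2 (2 r0 - 1)\<close>; \<open>a_eq\<close> is the
  remaining condition, on the coefficient of \<open>X\<close>.\<close>

locale real_rooted_regime =
  fixes a b r0 :: real
  assumes b: "b \<ge> 0" and r0: "1 / 3 \<le> r0" "r0 \<le> 1"
    and a_eq: "a = - 3 * r0\<^sup>2 + 2 * r0 + b * r0\<^sup>2 * (1 - 2 * r0)"
begin

text \<open>A pair with sum \<open>- (1 + s)\<close> and product \<open>r^2\<close> gives
  \<open>w = - r^2 s\<close> and \<open>a - b w = r^2 - s (1 + s)\<close>. Eliminating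
  \<open>w\<close> leaves a quadratic in \<open>s\<close>, of which this is the larger root.\<close>

definition s where "s r = (sqrt ((1 + b * r\<^sup>2)\<^sup>2 + 4 * (r\<^sup>2 - a)) - (1 + b * r\<^sup>2)) / 2"

definition W where "W r = - r\<^sup>2 * s r"

lemma disc_r0: "(1 + b * r0\<^sup>2)\<^sup>2 + 4 * (r0\<^sup>2 - a) = (4 * r0 - 1 + b * r0\<^sup>2)\<^sup>2"
  by (simp add: a_eq power2_eq_square algebra_simps)

lemma s_r0: "s r0 = 2 * r0 - 1"
proof -
  have "0 \<le> 4 * r0 - 1 + b * r0\<^sup>2" using b r0 by (intro add_nonneg_nonneg) auto
  thus ?thesis by (simp only: s_def disc_r0 real_sqrt_abs) simp
qed

lemma disc_nonneg:
  assumes "r \<ge> r0"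
  shows "0 \<le> (1 + b * r\<^sup>2)\<^sup>2 + 4 * (r\<^sup>2 - a)"
proof -
  have "r0\<^sup>2 \<le> r\<^sup>2" using assms r0 by (intro power_mono) auto
  moreover from this have "(1 + b * r0\<^sup>2)\<^sup>2 \<le> (1 + b * r\<^sup>2)\<^sup>2"
    using b mult_left_mono[of "r0\<^sup>2" "r\<^sup>2" b] by (intro power_mono) auto
  ultimately have "(4 * r0 - 1 + b * r0\<^sup>2)\<^sup>2 \<le> (1 + b * r\<^sup>2)\<^sup>2 + 4 * (r\<^sup>2 - a)"
    unfolding disc_r0[symmetric] by (intro add_mono mult_left_mono diff_mono) auto
  thus ?thesis by (rule order.trans[rotated]) simp
qed

lemma s_root:
  assumes "r \<ge> r0"
  shows "(s r)\<^sup>2 + (1 + b * r\<^sup>2) * s r + a - r\<^sup>2 = 0"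
proof -
  have "2 * s r + (1 + b * r\<^sup>2) = sqrt ((1 + b * r\<^sup>2)\<^sup>2 + 4 * (r\<^sup>2 - a))"
    by (simp add: s_def diff_divide_distrib)
  hence "(2 * s r + (1 + b * r\<^sup>2))\<^sup>2 = (1 + b * r\<^sup>2)\<^sup>2 + 4 * (r\<^sup>2 - a)"
    using disc_nonneg[OF assms] by simp
  thus ?thesis by (simp add: power2_eq_square algebra_simps)
qed

text \<open>Here and in \<open>less_s\<close> a point is compared with the larger root
  \<open>s r\<close> of a monic quadratic through the sign of the quadratic there; in the positive
  case the point must also not lie left of the vertex.\<close>

lemma s_less:
  assumes "0 < x\<^sup>2 + (1 + b * r\<^sup>2) * x + a - r\<^sup>2" "0 \<le> 2 * x + (1 + b * r\<^sup>2)"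
  shows "s r < x"
proof -
  have "sqrt ((1 + b * r\<^sup>2)\<^sup>2 + 4 * (r\<^sup>2 - a)) < 2 * x + (1 + b * r\<^sup>2)"
    using assms by (intro real_less_lsqrt) (auto simp: power2_eq_square algebra_simps)
  thus ?thesis by (simp add: s_def)
qed

lemma less_s:
  assumes "x\<^sup>2 + (1 + b * r\<^sup>2) * x + a - r\<^sup>2 < 0"
  shows "x < s r"
proof -
  have "2 * x + (1 + b * r\<^sup>2) < sqrt ((1 + b * r\<^sup>2)\<^sup>2 + 4 * (r\<^sup>2 - a))"
    using assms by (intro real_less_rsqrt) (auto simp: power2_eq_square algebra_simps)
  thus ?thesis by (simp add: s_def)
qed

text \<open>The three bounds come from the sign of the quadratic at \<open>- r\<close>,
  \<open>r\<close> and \<open>2 * r - 1\<close>; the first needs \<open>r0 \<ge> 1 / 3\<close>, the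
  second \<open>r0 \<le> 1\<close>. Together they put \<open>(1 + s r) / (2 * r)\<close> strictly
  between - 1 and 1, so that it is the cosine of an angle.\<close>

lemma s_bounds:
  assumes "r > r0"
  shows "\<bar>s r\<bar> < r" "1 + s r < 2 * r"
proof -
  have r: "r > 0" using assms r0 by linarith
  have cube: "r0 + b * r0 ^ 3 < r + b * r ^ 3"
    using assms r0 b by (intro add_less_le_mono mult_left_mono power_mono) auto
  have "r0 + b * r0 ^ 3 - a = (3 * r0 - 1) * (r0 + b * r0\<^sup>2)"
    by (simp add: a_eq power2_eq_square power3_eq_cube algebra_simps)
  also have "\<dots> \<ge> 0" using r0 b by (intro mult_nonneg_nonneg add_nonneg_nonneg) auto
  finally have "- r < s r"
    using cube by (intro less_s) (simp add: power2_eq_square power3_eq_cube algebra_simps)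
  moreover have "r0 + b * r0 ^ 3 + a = (1 - r0) * (3 * r0 + b * r0\<^sup>2)"
    by (simp add: a_eq power2_eq_square power3_eq_cube algebra_simps)
  hence "r0 + b * r0 ^ 3 + a \<ge> 0"
    using r0 b by (simp add: add_nonneg_nonneg)
  hence "s r < r"
    using cube r b by (intro s_less) (auto simp: power2_eq_square power3_eq_cube algebra_simps)
  ultimately show "\<bar>s r\<bar> < r" by linarith
  have "s r < 2 * r - 1"
  proof (rule s_less)
    \<comment> \<open>The factor \<open>r - r0\<close> splits off because
      \<open>s r0 = 2 * r0 - 1\<close>.\<close>
    have "(2 * r - 1)\<^sup>2 + (1 + b * r\<^sup>2) * (2 * r - 1) + a - r\<^sup>2 =
      (r - r0) * ((3 * (r + r0) - 2) + b * (2 * (r\<^sup>2 + r * r0 + r0\<^sup>2) - (r + r0)))"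
      by (simp add: a_eq power2_eq_square algebra_simps)
    also have "\<dots> > 0"
    proof (intro mult_pos_pos add_pos_nonneg mult_nonneg_nonneg b)
      have "0 \<le> (r - r0)\<^sup>2 + (r + r0) * (3 * (r + r0) - 2)"
        using assms r0 by (intro add_nonneg_nonneg mult_nonneg_nonneg) auto
      thus "0 \<le> 2 * (r\<^sup>2 + r * r0 + r0\<^sup>2) - (r + r0)"
        by (simp add: power2_eq_square algebra_simps)
    qed (use assms r0 in auto)
    finally show "0 < (2 * r - 1)\<^sup>2 + (1 + b * r\<^sup>2) * (2 * r - 1) + a - r\<^sup>2" .
    have "0 \<le> b * r\<^sup>2" using b by simp
    thus "0 \<le> 2 * (2 * r - 1) + (1 + b * r\<^sup>2)" using assms r0 by argo
  qed
  thus "1 + s r < 2 * r" by simp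
qed

lemma W_eq:
  assumes "r \<ge> r0"
  shows "a - b * W r = r\<^sup>2 - s r * (1 + s r)"
  using s_root[OF assms] by (simp add: W_def power2_eq_square algebra_simps)

text \<open>The value \<open>W r\<close> determines a cubic with exactly one real root, namely \<open>s r\<close>.\<close>
lemma inj_on_W: "inj_on W {r0<..}"
proof (rule inj_onI)
  fix r t assume rt: "r \<in> {r0<..}" "t \<in> {r0<..}" and eq: "W r = W t"
  define u v where "u = s r" and "v = s t"
  have a1: "a = r\<^sup>2 - u * (1 + u) + b * W r" and a2: "a = t\<^sup>2 - v * (1 + v) + b * W r"
    using W_eq[of r] W_eq[of t] rt eq by (auto simp: u_def v_def)
  have w1: "W r = - r\<^sup>2 * u" and w2: "W r = - t\<^sup>2 * v"
    using eq by (auto simp: u_def v_def W_def)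
  have "(v - u) * (v\<^sup>2 + (1 + u) * v + r\<^sup>2) =
      v ^ 3 + v\<^sup>2 + (r\<^sup>2 - u * (1 + u)) * v - r\<^sup>2 * u"
    by (simp add: power2_eq_square power3_eq_cube algebra_simps)
  also have "\<dots> = v ^ 3 + v\<^sup>2 + (t\<^sup>2 - v * (1 + v)) * v - t\<^sup>2 * v"
  proof -
    have "r\<^sup>2 - u * (1 + u) = t\<^sup>2 - v * (1 + v)" "r\<^sup>2 * u = t\<^sup>2 * v"
      using a1 a2 w1 w2 by linarith+
    thus ?thesis by simp
  qed
  also have "\<dots> = 0" by (simp add: power2_eq_square power3_eq_cube algebra_simps)
  finally have "v = u \<or> v\<^sup>2 + (1 + u) * v + r\<^sup>2 = 0" by simp
  moreover have "v\<^sup>2 + (1 + u) * v + r\<^sup>2 > 0"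
  proof -
    have "\<bar>1 + u\<bar> < 2 * r" using s_bounds[of r] rt unfolding u_def by auto
    hence "\<bar>1 + u\<bar>\<^sup>2 < (2 * r)\<^sup>2" by (intro power_strict_mono) auto
    hence "(1 + u)\<^sup>2 < 4 * r\<^sup>2" by (simp add: power_mult_distrib)
    moreover have "4 * (v\<^sup>2 + (1 + u) * v + r\<^sup>2) = (2 * v + (1 + u))\<^sup>2 + (4 * r\<^sup>2 - (1 + u)\<^sup>2)"
      by (simp add: power2_eq_square algebra_simps)
    ultimately show ?thesis by (smt (verit) zero_le_power2)
  qed
  ultimately have "v = u" by auto
  hence "r\<^sup>2 = t\<^sup>2" using a1 a2 by simp
  thus "r = t" using rt r0 by (auto simp: power2_eq_iff)
qed

lemma continuous_on_s: "continuous_on A s"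
  unfolding s_def by (intro continuous_intros) auto

text \<open>The ratio plays the role of \<open>2 cos \<phi>\<close>. It sinks below every positive
  level if \<open>b > 0\<close>, but in general only below levels above 1; so the curve reaches
  angles up to \<open>pi / 2\<close> and \<open>pi / 3\<close>, respectively.\<close>

lemma s_le_eventually:
  assumes "(b > 0 \<and> \<kappa> > 0) \<or> \<kappa> > 1"
  shows "\<forall>\<^sub>F r in at_top. (1 + s r) / r \<le> \<kappa>"
proof -
  have k: "\<kappa> > 0" using assms by auto
  have "filterlim (\<lambda>r. (\<kappa> * r - 1)\<^sup>2 + (1 + b * r\<^sup>2) * (\<kappa> * r - 1) + a - r\<^sup>2) at_top at_top"
  proof (cases "b > 0")
    case True
    thus ?thesis using k by real_asymp
  next
    case False
    hence "b = 0" "\<kappa> > 1" using b assms by auto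
    moreover from this have "\<kappa>\<^sup>2 - 1 > 0" by (simp add: power2_eq_square less_1_mult)
    hence "filterlim (\<lambda>r. (\<kappa>\<^sup>2 - 1) * r\<^sup>2 - \<kappa> * r + a) at_top at_top"
      by real_asymp
    ultimately show ?thesis by (simp add: power2_eq_square algebra_simps)
  qed
  hence "\<forall>\<^sub>F r in at_top. (\<kappa> * r - 1)\<^sup>2 + (1 + b * r\<^sup>2) * (\<kappa> * r - 1) + a - r\<^sup>2 > 0"
    unfolding filterlim_at_top_dense by blast
  moreover have "\<forall>\<^sub>F r in at_top. r > (1 / \<kappa> :: real)" by (rule eventually_gt_at_top)
  moreover have "\<forall>\<^sub>F r in at_top. r > (0 :: real)" by (rule eventually_gt_at_top)
  ultimately show ?thesis
  proof eventually_elim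
    case (elim r)
    have "0 \<le> 2 * (\<kappa> * r - 1) + (1 + b * r\<^sup>2)"
      using elim k b by (intro add_nonneg_nonneg) (auto simp: field_simps)
    hence "s r < \<kappa> * r - 1" using elim by (intro s_less)
    thus ?case using elim by (simp add: field_simps)
  qed
qed

text \<open>The condition on \<open>i\<close> puts the angle \<open>\<phi> i\<close> below
  \<open>pi / 2\<close> (for \<open>b > 0\<close>) or below \<open>pi / 3\<close>, where the curve
  attains it. The \<open>n\<close> alternating signs give \<open>n - 1\<close> zeros, one less than
  the degree bound.\<close>

lemma all_zeros_real_Pseq_if_enough_nodes:
  assumes n: "\<And>i. i < n \<Longrightarrow> (b > 0 \<and> 2 * Suc i < m + 2) \<or> 3 * Suc i < m + 2"
    and "n \<ge> 1" and deg: "degree (Pseq 1 [:a, - b:] [:0, 1:] m) \<le> n"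
  shows "all_zeros_real (Pseq 1 [:a, - b:] [:0, 1:] m)"
proof -
  define p where "p = Pseq 1 [:a, - b:] [:0, 1:] m"
  define \<phi> where "\<phi> i = real (Suc i) * pi / real (m + 2)" for i
  have \<phi>: "0 < \<phi> i" "\<phi> i < pi" "real (m + 2) * \<phi> i = real (Suc i) * pi" if "i < n" for i
    using n[OF that] by (auto simp: \<phi>_def field_simps simp flip: of_nat_Suc)
  have kappa: "(b > 0 \<and> 2 * cos (\<phi> i) > 0) \<or> 2 * cos (\<phi> i) > 1" if i: "i < n" for i
  proof (cases "3 * Suc i < m + 2")
    case True
    hence "3 * real (Suc i) * pi < real (m + 2) * pi" by (intro mult_strict_right_mono) auto
    hence "\<phi> i < pi / 3" by (simp add: \<phi>_def field_simps)
    hence "cos (pi / 3) < cos (\<phi> i)" using \<phi>[OF i] by (intro cos_monotone_0_pi) auto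
    thus ?thesis by (simp add: cos_60)
  next
    case False
    hence "b > 0" "2 * Suc i < m + 2" using n[OF i] by auto
    hence "2 * real (Suc i) * pi < real (m + 2) * pi" by (intro mult_strict_right_mono) auto
    hence "\<phi> i < pi / 2" by (simp add: \<phi>_def field_simps)
    thus ?thesis using \<phi>[OF i] \<open>b > 0\<close> by (auto intro!: cos_gt_zero)
  qed
  have "\<exists>\<rho>. \<forall>i<n. r0 < \<rho> i \<and> (1 + s (\<rho> i)) / \<rho> i = 2 * cos (\<phi> i) \<and> (\<forall>j<i. \<rho> j < \<rho> i)"
  proof (rule decreasing_hits)
    show "continuous_on {r0..} (\<lambda>r. (1 + s r) / r)"
      using r0 by (intro continuous_intros continuous_on_s) auto
    \<comment> \<open>At the double root the ratio is exactly 2, above every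
      \<open>2 * cos (\<phi> i)\<close>.\<close>
    show "2 * cos (\<phi> i) < (1 + s r0) / r0" if "i < n" for i
      using cos_monotone_0_pi[of 0 "\<phi> i"] \<phi>[OF that] r0 by (simp add: s_r0)
    show "2 * cos (\<phi> j) < 2 * cos (\<phi> i)" if "i < j" "j < n" for i j
    proof -
      have "\<phi> i < \<phi> j" using that by (simp add: \<phi>_def divide_strict_right_mono)
      thus ?thesis using \<phi>[of i] \<phi>[of j] that cos_monotone_0_pi[of "\<phi> i" "\<phi> j"] by simp
    qed
    show "\<exists>r\<ge>N. (1 + s r) / r \<le> 2 * cos (\<phi> i)" if "i < n" for i N
      using s_le_eventually[OF kappa[OF that]] unfolding eventually_at_top_linorder
      by (metis nle_le)
  qed
  then obtain \<rho> where \<rho>: "\<And>i. i < n \<Longrightarrow> r0 < \<rho> i"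
      "\<And>i. i < n \<Longrightarrow> (1 + s (\<rho> i)) / \<rho> i = 2 * cos (\<phi> i)"
      "\<And>i j. i < j \<Longrightarrow> j < n \<Longrightarrow> \<rho> i < \<rho> j" by metis
  have poly_W: "poly p w = hrec (- 1) (a - b * w) (- w) m" for w
    unfolding p_def poly_Pseq by (simp add: mult.commute)
  have sgn: "0 < (- 1) ^ i * (- 1) ^ m * poly p (W (\<rho> i))" if i: "i < n" for i
    unfolding poly_W
  proof (rule hrec_at_node)
    show "a - b * W (\<rho> i) = (\<rho> i)\<^sup>2 - s (\<rho> i) * (1 + s (\<rho> i))"
      using \<rho>(1)[OF i] by (intro W_eq) auto
    show "1 + s (\<rho> i) = 2 * \<rho> i * cos (\<phi> i)"
      using \<rho>(1,2)[OF i] r0 by (simp add: field_simps)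
  qed (use s_bounds[OF \<rho>(1)[OF i]] \<phi>[OF i] in \<open>auto simp: W_def\<close>)
  have "continuous_on {r0<..} (\<lambda>r. poly p (W r))"
    unfolding W_def by (intro continuous_intros continuous_on_s)
  from zeros_of_sign_changes[OF this \<rho>(1,3) sgn]
  obtain Z where Z: "finite Z" "card Z = n - 1" "Z \<subseteq> {r0<..}" "\<forall>z\<in>Z. poly p (W z) = 0"
    by blast
  have "card (W ` Z) = n - 1"
    using Z inj_on_subset[OF inj_on_W Z(3)] by (simp add: card_image)
  moreover have "p \<noteq> 0" using sgn[of 0] \<open>n \<ge> 1\<close> by auto
  ultimately show ?thesis
    using Z \<open>n \<ge> 1\<close> deg unfolding p_def[symmetric]
    by (intro all_zeros_real_if_roots[of "W ` Z"]) auto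
qed

lemma all_zeros_real_Pseq: "all_zeros_real (Pseq 1 [:a, - b:] [:0, 1:] m)"
proof (cases "m = 0")
  case True
  thus ?thesis by (simp add: all_zeros_real_degree_le_1)
next
  case False
  show ?thesis
  proof (cases "b = 0")
    case True
    show ?thesis
    proof (cases "m = 1")
      case True
      thus ?thesis by (simp add: all_zeros_real_degree_le_1)
    next
      case m: False
      \<comment> \<open>\<open>(m + 1) div 3\<close> is the largest \<open>n\<close> with
        \<open>3 * n < m + 2\<close>. It vanishes for \<open>m = 1\<close>, hence the separate case.
        For \<open>b > 0\<close> the analogous number is \<open>(m + 1) div 2\<close>.\<close>
      show ?thesis
      proof (rule all_zeros_real_Pseq_if_enough_nodes[of "(m + 1) div 3"])
        show "degree (Pseq 1 [:a, - b:] [:0, 1:] m) \<le> (m + 1) div 3"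
          using degree_Pseq_zero[of a m] \<open>b = 0\<close> by (auto intro: order.trans[OF _ div_le_mono])
      qed (use m \<open>m \<noteq> 0\<close> in auto)
    qed
  next
    case b': False
    show ?thesis
    proof (rule all_zeros_real_Pseq_if_enough_nodes[of "(m + 1) div 2"])
      show "degree (Pseq 1 [:a, - b:] [:0, 1:] m) \<le> (m + 1) div 2"
        using degree_Pseq[of a b m] by (auto intro: order.trans[OF _ div_le_mono])
    qed (use b' b \<open>m \<noteq> 0\<close> in auto)
  qed
qed

end

text \<open>The two inequalities say \<open>f 1 \<le> a\<close> and
  \<open>a \<le> f (1 / 3)\<close>, so the intermediate value theorem provides
  \<open>r0\<close>.\<close>

lemma real_rooted_regime_exists:
  fixes a b :: real
  assumes "b \<ge> 0" "1 + a + b \<ge> 0" "9 - 27 * a + b \<ge> 0"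
  obtains r0 where "real_rooted_regime a b r0"
proof -
  define f where "f r = - 3 * r\<^sup>2 + 2 * r + b * r\<^sup>2 * (1 - 2 * r)" for r :: real
  have "continuous_on {1/3..1} f" unfolding f_def by (intro continuous_intros)
  moreover have "f 1 \<le> a" "a \<le> f (1 / 3)"
    using assms by (auto simp: f_def power2_eq_square)
  ultimately obtain r where "1 / 3 \<le> r" "r \<le> 1" "f r = a"
    using IVT2'[of f 1 a "1/3"] by auto
  thus ?thesis using that[of r] assms by (auto simp: real_rooted_regime_def f_def)
qed

subsection \<open>Nonreal zeros near points with two dominant roots of equal modulus\<close>

text \<open>For \<open>\<rho> = x / y\<close> the hypothesis reads
  \<open>\<rho> + 1 / \<rho> = k - 2\<close> with right side in \<open>[- 2, 2]\<close>, which
  forces \<open>\<rho>\<close> to be one of the unimodular numbers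
  \<open>Complex c \<sigma>\<close>, \<open>Complex c (- \<sigma>)\<close>. The product form also
  covers \<open>y = 0\<close>.\<close>

lemma norm_eq_if_ratio_real:
  fixes x y :: complex
  assumes "(x + y)\<^sup>2 = of_real k * (x * y)" "0 \<le> k" "k \<le> 4"
  shows "norm x = norm y"
proof -
  define c where "c = (k - 2) / 2"
  define \<sigma> where "\<sigma> = sqrt (1 - c\<^sup>2)"
  have "1 - c\<^sup>2 = k * (4 - k) / 4" by (simp add: c_def power2_eq_square field_simps)
  moreover have "0 \<le> k * (4 - k)" using assms by simp
  ultimately have "0 \<le> 1 - c\<^sup>2" by linarith
  hence \<sigma>: "\<sigma>\<^sup>2 = 1 - c\<^sup>2" by (simp add: \<sigma>_def)
  hence n: "norm (Complex c \<sigma>) = 1" "norm (Complex c (- \<sigma>)) = 1"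
    by (simp_all add: cmod_def)
  have k: "k = 2 * c + 2" by (simp add: c_def field_simps)
  have "(x - of_real c * y)\<^sup>2 = (x + y)\<^sup>2 - of_real k * (x * y) - of_real (1 - c\<^sup>2) * y\<^sup>2"
    by (simp add: k power2_eq_square algebra_simps)
  also have "\<dots> = (\<i> * of_real \<sigma> * y)\<^sup>2"
    unfolding assms(1) \<sigma>[symmetric] by (simp add: power_mult_distrib)
  finally have "x - of_real c * y = \<i> * of_real \<sigma> * y \<or> x - of_real c * y = - (\<i> * of_real \<sigma> * y)"
    by (simp only: power2_eq_iff)
  hence "x = Complex c \<sigma> * y \<or> x = Complex c (- \<sigma>) * y"
    by (auto simp: Complex_eq algebra_simps)
  thus ?thesis using n by (auto simp: norm_mult)
qed

text \<open>A unimodular \<open>\<rho> = x / y\<close> satisfies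
  \<open>\<rho> + 1 / \<rho> = 2 * Re \<rho>\<close>. For \<open>y = 0\<close> the quotient is 0 by
  convention.\<close>

lemma ratio_real_if_norm_eq:
  fixes x y :: complex
  assumes "norm x = norm y"
  shows "(x + y)\<^sup>2 / (x * y) \<in> \<real>"
proof (cases "y = 0")
  case False
  define \<rho> where "\<rho> = x / y"
  have "norm \<rho> = 1" using assms False by (simp add: \<rho>_def norm_divide)
  hence "\<rho> * cnj \<rho> = 1" by (simp add: complex_norm_square[symmetric])
  hence inv: "inverse \<rho> = cnj \<rho>" by (rule inverse_unique)
  have "x \<noteq> 0" using assms False by auto
  hence "(x + y)\<^sup>2 / (x * y) = \<rho> + inverse \<rho> + 2"
    using False by (simp add: \<rho>_def field_simps power2_eq_square)
  also have "\<rho> + inverse \<rho> = of_real (2 * Re \<rho>)"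
    unfolding inv by (rule complex_add_cnj)
  finally show ?thesis by simp
qed simp

lemma quadratic_pair_exists:
  fixes p q :: complex
  obtains x y where "x + y = p" "x * y = q" "norm y \<le> norm x"
proof -
  define d where "d = csqrt (p\<^sup>2 - 4 * q)"
  have d: "d * d = p * p - 4 * q" unfolding d_def by (metis power2_csqrt power2_eq_square)
  define x y where "x = (p + d) / 2" and "y = (p - d) / 2"
  have 1: "x + y = p" unfolding x_def y_def by (simp add: field_simps)
  have "x * y = (p * p - d * d) / 4" by (simp add: x_def y_def algebra_simps)
  hence 2: "x * y = q" unfolding d by simp
  show thesis
  proof (cases "norm y \<le> norm x")
    case True
    with that[of x y] 1 2 show thesis by blast
  next
    case False
    with that[of y x] 1 2 show thesis by (simp add: add.commute mult.commute)
  qed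
qed

section \<open>Product and ratio of the other two roots as functions of one root\<close>

text \<open>The product \<open>x y\<close> of the other two roots when \<open>s\<close> is a root:
  \<open>x + y = - (1 + s)\<close> and \<open>w = - x y s\<close> turn the coefficient condition
  into \<open>a - b w = x y - s (1 + s)\<close>, which is solved for \<open>x y\<close>.\<close>

definition Rquo :: "'a::field \<Rightarrow> 'a \<Rightarrow> 'a \<Rightarrow> 'a" where
  "Rquo a b s = (s\<^sup>2 + s + a) / (1 - b * s)"

text \<open>If \<open>x\<close>, \<open>y\<close>, \<open>s\<close> are the roots of a cubic of the family, then \<open>Kquo a b s = (x + y)\<^sup>2 / (x y)\<close>;
  it lies in \<open>[0, 4]\<close> exactly when \<open>\<bar>x\<bar> = \<bar>y\<bar>\<close>.\<close>
definition Kquo :: "'a::field \<Rightarrow> 'a \<Rightarrow> 'a \<Rightarrow> 'a" where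
  "Kquo a b s = (1 + s)\<^sup>2 * (1 - b * s) / (s\<^sup>2 + s + a)"

lemma Kquo_times_Rquo:
  assumes "1 - b * s \<noteq> 0" "s\<^sup>2 + s + a \<noteq> 0"
  shows "Kquo a b s * Rquo a b s = (1 + s)\<^sup>2"
proof -
  have "p * u / v * (v / u) = p" if "u \<noteq> 0" "v \<noteq> 0" for p u v :: 'a
    using that by simp
  from this[OF assms] show ?thesis by (simp only: Kquo_def Rquo_def)
qed

text \<open>Constancy on a nonempty open set would make the cubic \<open>P\<close> vanish
  identically, and its coefficients then demand both \<open>k = 1\<close> and
  \<open>k = 2\<close>.\<close>

lemma Kquo_not_constant:
  fixes a b k :: complex
  assumes "open U" "U \<noteq> {}" "\<And>s. s \<in> U \<Longrightarrow> s\<^sup>2 + s + a \<noteq> 0"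
  shows "\<exists>s\<in>U. Kquo a b s \<noteq> k"
proof (rule ccontr)
  assume "\<not> (\<exists>s\<in>U. Kquo a b s \<noteq> k)"
  hence K: "Kquo a b s = k" if "s \<in> U" for s using that by blast
  define P where "P = [:1 - k * a, 2 - b - k, 1 - 2 * b - k, - b:]"
  have "poly P s = 0" if "s \<in> U" for s
  proof -
    have "(1 + s)\<^sup>2 * (1 - b * s) = k * (s\<^sup>2 + s + a)"
      using K[OF that] assms(3)[OF that] by (simp add: Kquo_def field_simps)
    thus ?thesis by (simp add: P_def power2_eq_square algebra_simps)
  qed
  hence "U \<subseteq> {s. poly P s = 0}" by blast
  moreover have "infinite U" using assms(1,2) finite_imp_not_open by blast
  ultimately have "P = 0" using poly_roots_finite finite_subset by blast
  hence "b = 0" "k = 2" "k = 1" by (auto simp: P_def)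
  thus False by simp
qed

lemma open_Kquo_image:
  fixes a b :: complex
  assumes "open U" "U \<subseteq> ball c e" "\<And>s. s \<in> ball c e \<Longrightarrow> s\<^sup>2 + s + a \<noteq> 0"
  shows "open (Kquo a b ` U)"
proof (cases "U = {}")
  case False
  hence ne: "ball c e \<noteq> {}" using assms(2) by blast
  show ?thesis
  proof (rule open_mapping_thm[OF _ open_ball connected_ball assms(1,2)])
    show "Kquo a b holomorphic_on ball c e"
      unfolding Kquo_def[abs_def] using assms(3) by (intro holomorphic_intros) auto
    show "\<not> Kquo a b constant_on ball c e"
      using Kquo_not_constant[OF open_ball ne assms(3)] unfolding constant_on_def by blast
  qed
qed simp

lemma open_complex_not_subset_Reals:
  fixes z :: complex
  assumes "open U" "z \<in> U"
  shows "\<exists>w\<in>U. w \<notin> \<real>"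
proof (cases "z \<in> \<real>")
  case True
  obtain e where e: "e > 0" "ball z e \<subseteq> U" using assms open_contains_ball by blast
  define w where "w = z + \<i> * of_real (e / 2)"
  have "w \<in> ball z e" using e by (simp add: w_def dist_norm norm_mult)
  moreover have "w \<notin> \<real>" using True e by (auto simp: w_def complex_is_Real_iff)
  ultimately show ?thesis using e by blast
qed (use assms in blast)

section \<open>Limits of n-th roots and nonreal zeros\<close>

text \<open>The polynomial factor of \<open>norm_hrec_le\<close> disappears under the root. The
  shift to \<open>Suc n\<close> avoids the zeroth root.\<close>

lemma root_bound_tendsto: "(\<lambda>n. root (Suc n) ((real (Suc n) + 1)\<^sup>2)) \<longlonglongrightarrow> 1"
proof -
  have "(\<lambda>n. ((real (Suc n) + 1)\<^sup>2) powr (1 / real (Suc n))) \<longlonglongrightarrow> 1"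
    by real_asymp
  thus ?thesis by (simp add: root_powr_inverse)
qed

lemma root_const_tendsto:
  assumes "c > 0"
  shows "(\<lambda>n. root (Suc n) c) \<longlonglongrightarrow> 1"
  using LIMSEQ_Suc[OF LIMSEQ_root_const[OF assms]] .

lemma root_mult_power:
  assumes "0 \<le> c"
  shows "(root (Suc n) c * M) ^ Suc n = c * M ^ Suc n"
proof -
  have "root (Suc n) c ^ Suc n = c" by (rule real_root_pow_pos2) (use assms in auto)
  thus ?thesis by (simp only: power_mult_distrib)
qed

lemma le_root_mult:
  fixes t :: real
  assumes "t ^ Suc n \<le> c * M ^ Suc n" "0 \<le> c" "0 \<le> M"
  shows "t \<le> root (Suc n) c * M"
proof (rule power_le_imp_le_base)
  show "t ^ Suc n \<le> (root (Suc n) c * M) ^ Suc n"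
    unfolding root_mult_power[OF assms(2)] by (rule assms(1))
  show "0 \<le> root (Suc n) c * M"
    using assms by (intro mult_nonneg_nonneg real_root_ge_zero)
qed

lemma root_mult_le:
  fixes t :: real
  assumes "c * M ^ Suc n \<le> t ^ Suc n" "0 \<le> c" "0 \<le> t"
  shows "root (Suc n) c * M \<le> t"
proof (rule power_le_imp_le_base)
  show "(root (Suc n) c * M) ^ Suc n \<le> t ^ Suc n"
    unfolding root_mult_power[OF assms(2)] by (rule assms(1))
qed (rule assms(3))

text \<open>
  If the \<open>h m\<close> had no zeros near \<open>s0\<close>, their \<open>m\<close>-th roots would, by Montel, have a holomorphic limit \<open>g\<close>
  along a subsequence, with \<open>\<bar>g\<bar> = max \<bar>x\<bar> \<bar>y\<bar>\<close> wherever \<open>\<bar>x\<bar> \<noteq> \<bar>y\<bar>\<close>. Then \<open>x y / g\<^sup>2\<close> would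
  attain its maximal modulus 1 at \<open>s0\<close> without being constant.
\<close>
lemma dominant_pair_imp_nonreal_zero:
  fixes a b k :: real and s0 :: complex
  assumes k: "Kquo a b s0 = complex_of_real k" "0 < k" "k < 4"
    and dom: "(norm s0)\<^sup>2 < norm (Rquo (of_real a) (of_real b) s0)" and "s0 \<notin> \<real>"
  shows "\<exists>m w. hrec (- 1) (of_real a - of_real b * w) (- w) m = (0 :: complex) \<and> w \<notin> \<real>"
proof (rule ccontr)
  assume "\<not> ?thesis"
  hence real: "w \<in> \<real>" if "hrec (- 1) (of_real a - of_real b * w) (- w) m = (0 :: complex)" for w m
    using that by blast
  define A B where "A = complex_of_real a" and "B = complex_of_real b"
  define R where "R = Rquo A B"
  \<comment> \<open>\<open>w s\<close> is the parameter for which \<open>s\<close> is a root of the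
    cubic, so \<open>h m\<close> is studied as a function of that root.\<close>
  define w where "w s = - R s * s" for s
  define h where "h m s = hrec (- 1) (A - B * w s) (- w s) m" for m s
  have s0_ne: "1 - B * s0 \<noteq> 0" "s0\<^sup>2 + s0 + A \<noteq> 0"
    using k by (auto simp: Kquo_def A_def B_def)
  \<comment> \<open>From \<open>\<bar>s\<bar>^2 < \<bar>R s\<bar> = \<bar>x\<bar>
    \<bar>y\<bar>\<close> it follows that the larger of the other two roots exceeds \<open>s\<close>
    in modulus.\<close>
  have roots: "\<exists>x y. x + y = - (1 + s) \<and> x * y = R s \<and> norm y \<le> norm x \<and> norm s < norm x \<and>
      (norm x)\<^sup>2 \<ge> norm (R s) \<and> A - B * w s = x * y + x * s + y * s \<and> w s = - (x * y * s) \<and>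
      (\<forall>m. h m s = hrec (x + y + s) (x * y + x * s + y * s) (x * y * s) m)"
    if s: "1 - B * s \<noteq> 0" "(norm s)\<^sup>2 < norm (R s)" for s
  proof -
    obtain x y where xy: "x + y = - (1 + s)" "x * y = R s" "norm y \<le> norm x"
      by (rule quadratic_pair_exists)
    have le: "norm (R s) \<le> (norm x)\<^sup>2"
      unfolding xy(2)[symmetric] norm_mult power2_eq_square using xy(3) by (intro mult_left_mono) auto
    hence "norm s < norm x"
      using s(2) by (meson le_less_trans less_le_trans norm_ge_zero power_less_imp_less_base)
    moreover have "R s * (1 - B * s) = s\<^sup>2 + s + A"
      using s(1) by (simp add: R_def Rquo_def)
    hence "A - B * w s = R s - (1 + s) * s"
      by (simp add: w_def power2_eq_square algebra_simps)
    hence e2: "A - B * w s = x * y + x * s + y * s"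
      unfolding xy(1)[symmetric] xy(2)[symmetric]
      using xy(1) by (metis (no_types, lifting) add.assoc add_uminus_conv_diff distrib_right mult_minus_left)
    moreover have e3: "- w s = x * y * s" and "w s = - (x * y * s)" by (simp_all add: w_def xy)
    moreover have e1: "x + y + s = - 1" by (simp add: xy)
    ultimately show ?thesis
      using xy le unfolding h_def e1 e2 e3 by - (rule exI[of _ x], rule exI[of _ y], auto)
  qed
  have pair_eq: "norm x = norm y" if xy: "x + y = - (1 + s0)" "x * y = R s0" for x y
  proof (rule norm_eq_if_ratio_real)
    show "(x + y)\<^sup>2 = of_real k * (x * y)"
      using Kquo_times_Rquo[OF s0_ne] k(1)
      unfolding xy R_def A_def B_def power2_minus by simp
  qed (use k in auto)
  \<comment> \<open>For real \<open>w s0\<close> the cubic has real coefficients, so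
    \<open>cnj s0\<close> is \<open>x\<close> or \<open>y\<close>. As \<open>x\<close> and
    \<open>y\<close> have equal modulus, \<open>\<bar>R s0\<bar> = \<bar>s0\<bar>^2\<close> would
    follow, against \<open>dom\<close>.\<close>
  have w_nonreal: "w s0 \<notin> \<real>"
  proof
    assume "w s0 \<in> \<real>"
    then obtain v where v: "w s0 = of_real v" by (auto elim: Reals_cases)
    obtain x y where xy: "x + y = - (1 + s0)" "x * y = R s0"
      and e: "A - B * w s0 = x * y + x * s0 + y * s0" "w s0 = - (x * y * s0)"
      using roots[of s0] s0_ne dom by (auto simp: R_def A_def B_def)
    define cub where "cub t = t ^ 3 + t\<^sup>2 + (A - B * of_real v) * t + of_real v" for t :: complex
    have cub: "cub t = (t - x) * (t - y) * (t - s0)" for t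
    proof -
      have "cub t = t ^ 3 - (x + y + s0) * t\<^sup>2 + (x * y + x * s0 + y * s0) * t - x * y * s0"
        using e unfolding cub_def v by (simp add: xy)
      thus ?thesis by (simp add: power2_eq_square power3_eq_cube algebra_simps)
    qed
    have "cub (cnj s0) = cnj (cub s0)" by (simp add: cub_def A_def B_def)
    hence "cub (cnj s0) = 0" by (simp add: cub)
    hence "cnj s0 = x \<or> cnj s0 = y"
      using \<open>s0 \<notin> \<real>\<close> by (auto simp: cub complex_cnj_cancel_iff Reals_cnj_iff)
    hence n: "norm x = norm s0 \<or> norm y = norm s0" by (metis complex_mod_cnj)
    have "norm x = norm y" using pair_eq[OF xy] .
    hence "norm (R s0) = (norm s0)\<^sup>2"
      using n unfolding xy(2)[symmetric] norm_mult power2_eq_square by auto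
    thus False using dom by (simp add: R_def A_def B_def)
  qed
  have "isCont R s0" "isCont w s0"
    using s0_ne unfolding w_def R_def Rquo_def[abs_def] by (auto intro!: continuous_intros)
  hence "\<forall>\<^sub>F s in nhds s0. 1 - B * s \<noteq> 0 \<and> s\<^sup>2 + s + A \<noteq> 0 \<and> norm (R s) - (norm s)\<^sup>2 > 0 \<and> Im (w s) \<noteq> 0"
  proof (intro eventually_conj)
    show "\<forall>\<^sub>F s in nhds s0. 1 - B * s \<noteq> 0"
      by (rule tendsto_imp_eventually_ne[OF _ s0_ne(1)]) (intro tendsto_intros filterlim_ident)
    show "\<forall>\<^sub>F s in nhds s0. s\<^sup>2 + s + A \<noteq> 0"
      by (rule tendsto_imp_eventually_ne[OF _ s0_ne(2)]) (intro tendsto_intros filterlim_ident)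
    have tR: "(R \<longlongrightarrow> R s0) (nhds s0)" and tw: "(w \<longlongrightarrow> w s0) (nhds s0)"
      using \<open>isCont R s0\<close> \<open>isCont w s0\<close> unfolding isCont_def by (metis tendsto_at_iff_tendsto_nhds)+
    have "((\<lambda>s. norm (R s) - (norm s)\<^sup>2) \<longlongrightarrow> norm (R s0) - (norm s0)\<^sup>2) (nhds s0)"
      by (intro tendsto_intros tR filterlim_ident)
    thus "\<forall>\<^sub>F s in nhds s0. norm (R s) - (norm s)\<^sup>2 > 0"
      by (rule order_tendstoD) (use dom in \<open>simp add: R_def A_def B_def\<close>)
    show "\<forall>\<^sub>F s in nhds s0. Im (w s) \<noteq> 0"
      by (rule tendsto_imp_eventually_ne[OF tendsto_Im[OF tw]])
         (use w_nonreal in \<open>simp add: complex_is_Real_iff\<close>)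
  qed
  then obtain \<epsilon> where \<epsilon>: "\<epsilon> > 0" and near: "\<And>s. dist s s0 < \<epsilon> \<Longrightarrow> 1 - B * s \<noteq> 0 \<and> s\<^sup>2 + s + A \<noteq> 0 \<and>
      norm (R s) - (norm s)\<^sup>2 > 0 \<and> Im (w s) \<noteq> 0"
    unfolding eventually_nhds_metric by blast
  define D where "D = ball s0 \<epsilon>"
  have D: "1 - B * s \<noteq> 0" "s\<^sup>2 + s + A \<noteq> 0" "(norm s)\<^sup>2 < norm (R s)" "w s \<notin> \<real>" if "s \<in> D" for s
    using near[of s] that by (auto simp: D_def dist_commute complex_is_Real_iff)
  have R0: "R s \<noteq> 0" if "s \<in> D" for s using D[OF that] by (auto simp: R_def Rquo_def)
  have D_open: "open D" "connected D" "convex D" "s0 \<in> D" using \<epsilon> by (auto simp: D_def)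
  have holR: "R holomorphic_on D"
    unfolding R_def Rquo_def[abs_def] using D(1) by (intro holomorphic_intros) auto
  hence holw: "w holomorphic_on D" unfolding w_def by (intro holomorphic_intros)
  have holh: "h m holomorphic_on D" for m
  proof (induction m rule: nat_induct3)
    case (4 n)
    have "h (Suc (Suc (Suc n))) =
      (\<lambda>s. - h (Suc (Suc n)) s - (A - B * w s) * h (Suc n) s - w s * h n s)"
      by (auto simp: h_def)
    thus ?case using 4 by (auto intro!: holomorphic_intros holw)
  qed (auto simp: h_def[abs_def] intro!: holomorphic_intros holw)
  have h0: "h m s \<noteq> 0" if "s \<in> D" for m s
    using real[of "w s" m] D(4)[OF that] unfolding h_def A_def B_def by blast
  \<comment> \<open>Zero-free functions on a disc have holomorphic logarithms, hence holomorphic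
    roots: \<open>f n\<close> below is a \<open>Suc n\<close>-th root of
    \<open>h (Suc n)\<close>.\<close>
  have "\<exists>L. L holomorphic_on D \<and> (\<forall>s\<in>D. exp (L s) = h m s)" for m
    using holomorphic_logarithm_exists[OF D_open(3,1) holh h0 D_open(4), of m] by metis
  then obtain L where L: "\<And>m. L m holomorphic_on D" "\<And>m s. s \<in> D \<Longrightarrow> exp (L m s) = h m s"
    by metis
  define f where "f n s = exp (L (Suc n) s / of_nat (Suc n))" for n s
  have holf: "f n holomorphic_on D" for n
    unfolding f_def[abs_def] by (intro holomorphic_intros L) auto
  have f_pow: "norm (f n s) ^ Suc n = norm (h (Suc n) s)" if "s \<in> D" for n s
  proof -
    have "f n s ^ Suc n = exp (of_nat (Suc n) * (L (Suc n) s / of_nat (Suc n)))"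
      unfolding f_def by (rule exp_of_nat_mult[symmetric])
    also have "\<dots> = h (Suc n) s" using L(2)[OF that] by (simp del: of_nat_Suc)
    finally show ?thesis by (metis norm_power)
  qed
  have upper: "norm (f n s) \<le> root (Suc n) ((real (Suc n) + 1)\<^sup>2) * M"
    if s: "s \<in> D" and xy: "\<And>m. h m s = hrec (x + y + s) (x * y + x * s + y * s) (x * y * s) m"
      and M: "norm x \<le> M" "norm y \<le> M" "norm s \<le> M"
    for n s x y M
  proof -
    have "M \<ge> 0" using M(1) norm_ge_zero order.trans by blast
    have "norm (f n s) ^ Suc n \<le> (real (Suc n) + 1)\<^sup>2 * M ^ Suc n"
      unfolding f_pow[OF s] xy by (rule norm_hrec_le[OF M])
    thus ?thesis using \<open>M \<ge> 0\<close> by (intro le_root_mult) auto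
  qed
  obtain C where C: "\<And>n. \<bar>root (Suc n) ((real (Suc n) + 1)\<^sup>2)\<bar> \<le> C"
    using convergent_imp_Bseq[OF convergentI[OF root_bound_tendsto]]
    unfolding Bseq_def real_norm_def by blast
  have C0: "C \<ge> 0" using C[of 0] by linarith
  \<comment> \<open>The root \<open>x\<close> is chosen pointwise, without continuity in
    \<open>s\<close>. It is therefore replaced by a coefficient bound that is continuous and so
    bounded on compact sets, as Montel's theorem requires.\<close>
  have loc_bound: "norm (f n s) \<le> C * (1 + norm (1 + s) + norm (R s))" if s: "s \<in> D" for n s
  proof -
    define M where "M = 1 + norm (1 + s) + norm (R s)"
    obtain x y where xy: "x + y = - (1 + s)" "x * y = R s" "norm y \<le> norm x" "norm s < norm x"
      and hr: "\<And>m. h m s = hrec (x + y + s) (x * y + x * s + y * s) (x * y * s) m"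
      using roots[of s] D[OF s] by metis
    have "norm x \<le> M"
    proof (cases "norm x \<le> 1")
      case False
      have "x * x = (x + y) * x - x * y" by (simp add: algebra_simps)
      hence "norm x * norm x \<le> norm (1 + s) * norm x + norm (R s)"
        unfolding xy by (metis norm_minus_cancel norm_mult norm_triangle_ineq4)
      also have "norm (R s) \<le> norm (R s) * norm x"
        using False by (simp add: mult_le_cancel_left1)
      finally have "norm x * norm x \<le> (norm (1 + s) + norm (R s)) * norm x"
        by (simp add: algebra_simps)
      hence "norm x \<le> norm (1 + s) + norm (R s)"
        using False by (auto simp: mult_le_cancel_right)
      thus ?thesis by (simp add: M_def)
    qed (simp add: M_def add_increasing2)
    hence "norm (f n s) \<le> root (Suc n) ((real (Suc n) + 1)\<^sup>2) * M"
      using xy by (intro upper[OF s hr]) auto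
    also have "\<dots> \<le> C * M"
      using C[of n] by (intro mult_right_mono) (auto simp: M_def)
    finally show ?thesis unfolding M_def .
  qed
  have bounded: "\<exists>B. \<forall>g\<in>range f. \<forall>s\<in>K. norm (g s) \<le> B" if K: "compact K" "K \<subseteq> D" for K
  proof -
    have "compact ((\<lambda>s. C * (1 + norm (1 + s) + norm (R s))) ` K)"
      using K holomorphic_on_imp_continuous_on[OF holR]
      by (intro compact_continuous_image continuous_intros) (auto intro: continuous_on_subset)
    then obtain B where B: "\<forall>y\<in>(\<lambda>s. C * (1 + norm (1 + s) + norm (R s))) ` K. norm y \<le> B"
      using compact_imp_bounded bounded_iff by blast
    have "norm (f n s) \<le> B" if "s \<in> K" for n s
    proof -
      have "norm (C * (1 + norm (1 + s) + norm (R s))) \<le> B" using B that by blast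
      thus ?thesis using loc_bound[of s n] that K(2) unfolding real_norm_def by force
    qed
    thus ?thesis by blast
  qed
  obtain g r where g: "g holomorphic_on D" and r: "strict_mono (r :: nat \<Rightarrow> nat)"
    and lim: "\<And>s. s \<in> D \<Longrightarrow> (\<lambda>n. f (r n) s) \<longlonglongrightarrow> g s"
  proof (rule Montel[OF D_open(1), of "range f" f])
    show "F holomorphic_on D" if "F \<in> range f" for F using that holf by blast
    show "\<exists>B. \<forall>F\<in>range f. \<forall>s\<in>K. norm (F s) \<le> B" if "compact K" "K \<subseteq> D" for K
      using that by (rule bounded)
  qed auto
  have upper_s0: "(norm (g s0))\<^sup>2 \<le> norm (R s0)"
  proof -
    obtain x y where xy: "x + y = - (1 + s0)" "x * y = R s0" "norm y \<le> norm x" "norm s0 < norm x"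
      and hr: "\<And>m. h m s0 = hrec (x + y + s0) (x * y + x * s0 + y * s0) (x * y * s0) m"
      using roots[of s0] D[OF D_open(4)] by metis
    have eq: "norm x = norm y" using pair_eq[OF xy(1,2)] .
    have "norm (f (r n) s0) \<le> root (Suc (r n)) ((real (Suc (r n)) + 1)\<^sup>2) * norm x" for n
      using xy D_open by (intro upper[OF _ hr]) auto
    moreover have "(\<lambda>n. root (Suc (r n)) ((real (Suc (r n)) + 1)\<^sup>2) * norm x) \<longlonglongrightarrow> 1 * norm x"
      using LIMSEQ_subseq_LIMSEQ[OF root_bound_tendsto r] by (intro tendsto_intros) (simp add: o_def)
    ultimately have "norm (g s0) \<le> 1 * norm x"
      using tendsto_norm[OF lim[OF D_open(4)]] by (intro LIMSEQ_le) auto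
    hence "(norm (g s0))\<^sup>2 \<le> (norm x)\<^sup>2" by (intro power_mono) auto
    also have "\<dots> = norm (R s0)"
      unfolding xy(2)[symmetric] norm_mult eq power2_eq_square ..
    finally show ?thesis .
  qed
  \<comment> \<open>A nonreal \<open>Kquo\<close> excludes
    \<open>\<bar>x\<bar> = \<bar>y\<bar>\<close>, so \<open>x\<close> alone dominates and
    \<open>h n s\<close> behaves like \<open>l * x ^ n\<close> with \<open>l \<noteq> 0\<close>.
    Hence \<open>\<bar>g s\<bar>^2 \<ge> \<bar>x\<bar>^2 > \<bar>x y\<bar>\<close>.\<close>
  have lower: "norm (R s) < (norm (g s))\<^sup>2" if s: "s \<in> D" and K: "Kquo A B s \<notin> \<real>" for s
  proof -
    obtain x y where xy: "x + y = - (1 + s)" "x * y = R s" "norm y \<le> norm x" "norm s < norm x"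
      and hr: "\<And>m. h m s = hrec (x + y + s) (x * y + x * s + y * s) (x * y * s) m"
      using roots[of s] D[OF s] by metis
    have "(x + y)\<^sup>2 / (x * y) = Kquo A B s"
      unfolding xy power2_minus Kquo_times_Rquo[OF D(1,2)[OF s], symmetric] R_def[symmetric]
      using R0[OF s] by simp
    hence "norm x \<noteq> norm y" using ratio_real_if_norm_eq[of x y] K by metis
    hence lt: "norm y < norm x" using xy(3) by simp
    define l where "l = 1 / ((1 - y / x) * (1 - s / x))"
    have "1 - y / x \<noteq> 0" "1 - s / x \<noteq> 0" using lt xy(4) by auto
    hence "l \<noteq> 0" by (simp add: l_def)
    have "(\<lambda>n. norm (h n s / x ^ n)) \<longlonglongrightarrow> norm l"
      unfolding hr l_def by (intro tendsto_norm hrec_dominant_limit lt xy(4))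
    hence "\<forall>\<^sub>F n in sequentially. norm l / 2 < norm (h n s / x ^ n)"
      by (rule order_tendstoD) (use \<open>l \<noteq> 0\<close> in simp)
    hence "\<forall>\<^sub>F n in sequentially. norm l / 2 < norm (h (Suc (r n)) s / x ^ Suc (r n))"
      using filterlim_subseq[OF r] filterlim_Suc
      by (intro eventually_compose_filterlim[of _ sequentially "\<lambda>n. Suc (r n)"])
         (auto intro: filterlim_compose)
    hence "\<forall>\<^sub>F n in sequentially. root (Suc (r n)) (norm l / 2) * norm x \<le> norm (f (r n) s)"
    proof eventually_elim
      case (elim n)
      have x: "norm x > 0" using lt by (meson le_less_trans norm_ge_zero)
      have "norm l / 2 * norm x ^ Suc (r n) \<le> norm (h (Suc (r n)) s)"
        using elim x
        by (simp add: norm_divide norm_power pos_less_divide_eq less_imp_le del: power_Suc)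
      thus ?case unfolding f_pow[OF s, symmetric] by (intro root_mult_le) auto
    qed
    moreover have "(\<lambda>n. root (Suc (r n)) (norm l / 2) * norm x) \<longlonglongrightarrow> 1 * norm x"
      using LIMSEQ_subseq_LIMSEQ[OF root_const_tendsto r, of "norm l / 2"] \<open>l \<noteq> 0\<close>
      by (intro tendsto_intros) (simp add: o_def)
    ultimately have "1 * norm x \<le> norm (g s)"
      using tendsto_norm[OF lim[OF s]] by (intro tendsto_le[of sequentially]) auto
    hence "(norm x)\<^sup>2 \<le> (norm (g s))\<^sup>2" by (intro power_mono) auto
    moreover have "norm (R s) < (norm x)\<^sup>2"
      unfolding xy(2)[symmetric] norm_mult power2_eq_square using lt
      by (intro mult_strict_left_mono) (auto intro: le_less_trans[of 0 "norm y"])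
    ultimately show ?thesis by linarith
  qed
  have nonreal_dense: "\<exists>s\<in>V. Kquo A B s \<notin> \<real>" if V: "open V" "V \<subseteq> D" "V \<noteq> {}" for V
  proof -
    have "open (Kquo A B ` V)"
      using V D(2) unfolding D_def by (intro open_Kquo_image) auto
    thus ?thesis using V(3) open_complex_not_subset_Reals by blast
  qed
  \<comment> \<open>A violation would persist on an open set, which contains a point with nonreal
    \<open>Kquo\<close>, contradicting \<open>lower\<close>.\<close>
  have ge: "norm (R s) \<le> (norm (g s))\<^sup>2" if "s \<in> D" for s
  proof (rule ccontr)
    assume *: "\<not> ?thesis"
    define V where "V = {s \<in> D. norm (R s) - (norm (g s))\<^sup>2 \<in> {0<..}}"
    have "open V"
      unfolding V_def using D_open(1) holomorphic_on_imp_continuous_on[OF holR]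
        holomorphic_on_imp_continuous_on[OF g]
      by (intro continuous_open_preimage[unfolded vimage_def Int_def mem_Collect_eq]) 
         (auto intro!: continuous_intros)
    moreover have "s \<in> V" using * that by (auto simp: V_def)
    ultimately obtain t where "t \<in> V" "Kquo A B t \<notin> \<real>"
      using nonreal_dense[of V] by (auto simp: V_def)
    thus False using lower[of t] by (auto simp: V_def)
  qed
  have g0: "g s \<noteq> 0" if "s \<in> D" for s
    using ge[OF that] R0[OF that] by auto
  define G where "G s = R s / (g s)\<^sup>2" for s
  have "G holomorphic_on D"
    unfolding G_def using g0 by (intro holomorphic_intros holR g) auto
  moreover have "norm (G s) \<le> norm (G s0)" if "s \<in> D" for s
  proof -
    have "norm (G s) \<le> 1"
      using ge[OF that] g0[OF that] by (simp add: G_def norm_divide norm_power)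
    also have "1 \<le> norm (G s0)"
      using upper_s0 g0[OF D_open(4)] by (simp add: G_def norm_divide norm_power)
    finally show ?thesis .
  qed
  ultimately have "G constant_on D"
    using maximum_modulus_principle[of G D D s0] D_open by blast
  moreover obtain s where s: "s \<in> D" "Kquo A B s \<notin> \<real>"
    using nonreal_dense[of D] D_open by auto
  ultimately have "G s = G s0" using D_open(4) unfolding constant_on_def by metis
  moreover have "norm (G s) < 1"
    using lower[OF s] g0[OF s(1)] by (simp add: G_def norm_divide norm_power)
  moreover have "1 \<le> norm (G s0)"
    using upper_s0 g0[OF D_open(4)] by (simp add: G_def norm_divide norm_power)
  ultimately show False by simp
qed

section \<open>Local maxima of \<open>Kquo\<close> on the real line\<close>

text \<open>By the open mapping theorem a value slightly above the real local maximum is taken near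
  \<open>t0\<close>. No real point nearby can take it, so
  \<open>dominant_pair_imp_nonreal_zero\<close> applies to a nonreal preimage.\<close>

lemma real_local_max_imp_nonreal_zero:
  fixes a b t0 \<delta> :: real
  assumes "1 - b * t0 \<noteq> 0" "t0\<^sup>2 + t0 + a \<noteq> 0"
    and K: "0 \<le> Kquo a b t0" "Kquo a b t0 < 4"
    and dom: "t0\<^sup>2 < \<bar>Rquo a b t0\<bar>"
    and "\<delta> > 0" and max: "\<And>t. \<bar>t - t0\<bar> < \<delta> \<Longrightarrow> Kquo a b t \<le> Kquo a b t0"
  shows "\<exists>m w. hrec (- 1) (of_real a - of_real b * w) (- w) m = (0 :: complex) \<and> w \<notin> \<real>"
proof -
  define A B T where "A = complex_of_real a" and "B = complex_of_real b" and "T = complex_of_real t0"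
  have of_real_quo: "Kquo A B (of_real t) = of_real (Kquo a b t)"
      "Rquo A B (of_real t) = of_real (Rquo a b t)" for t
    by (simp_all add: Kquo_def Rquo_def A_def B_def)
  have ne: "1 - B * T \<noteq> 0" "T\<^sup>2 + T + A \<noteq> 0"
    using assms(1,2) unfolding A_def B_def T_def
    by (metis of_real_1 of_real_diff of_real_eq_0_iff of_real_mult,
        metis of_real_add of_real_eq_0_iff of_real_power)
  have "\<forall>\<^sub>F s in nhds T. s\<^sup>2 + s + A \<noteq> 0 \<and> norm (Rquo A B s) - (norm s)\<^sup>2 > 0"
  proof (intro eventually_conj)
    show "\<forall>\<^sub>F s in nhds T. s\<^sup>2 + s + A \<noteq> 0"
      by (rule tendsto_imp_eventually_ne[OF _ ne(2)]) (intro tendsto_intros filterlim_ident)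
    have "((\<lambda>s. norm (Rquo A B s) - (norm s)\<^sup>2) \<longlongrightarrow> norm (Rquo A B T) - (norm T)\<^sup>2) (nhds T)"
      unfolding Rquo_def using ne by (intro tendsto_intros filterlim_ident) auto
    thus "\<forall>\<^sub>F s in nhds T. norm (Rquo A B s) - (norm s)\<^sup>2 > 0"
      by (rule order_tendstoD) (use dom in \<open>simp add: T_def of_real_quo\<close>)
  qed
  then obtain \<epsilon> where \<epsilon>: "\<epsilon> > 0" and near: "\<And>s. dist s T < \<epsilon> \<Longrightarrow>
      s\<^sup>2 + s + A \<noteq> 0 \<and> norm (Rquo A B s) - (norm s)\<^sup>2 > 0"
    unfolding eventually_nhds_metric by blast
  define D where "D = ball T (min \<epsilon> \<delta>)"
  have "open (Kquo A B ` D)"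
    unfolding D_def using near by (intro open_Kquo_image) (auto simp: dist_commute)
  moreover have "of_real (Kquo a b t0) \<in> Kquo A B ` D"
    using \<epsilon> \<open>\<delta> > 0\<close> unfolding D_def T_def by (intro image_eqI[of _ _ T]) (auto simp: of_real_quo T_def)
  ultimately obtain e where e: "e > 0" "ball (complex_of_real (Kquo a b t0)) e \<subseteq> Kquo A B ` D"
    using open_contains_ball by blast
  \<comment> \<open>The two terms of the minimum keep \<open>k\<close> inside the ball and below 4;
    lying strictly above the maximum makes \<open>k\<close> positive even when the maximum is
    0.\<close>
  define k where "k = Kquo a b t0 + min (e / 2) ((4 - Kquo a b t0) / 2)"
  have k: "0 < k" "k < 4" "Kquo a b t0 < k" "k - Kquo a b t0 < e"
    using e K unfolding k_def min_def by (auto split: if_splits) (simp_all add: field_simps)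
  have "complex_of_real k \<in> ball (complex_of_real (Kquo a b t0)) e"
    using k by (simp add: dist_norm flip: of_real_diff)
  then obtain s where s: "s \<in> D" "Kquo A B s = of_real k" using e by (metis imageE subsetD)
  have "s \<notin> \<real>"
  proof
    assume "s \<in> \<real>"
    then obtain t where t: "s = of_real t" by (auto elim: Reals_cases)
    have "\<bar>t - t0\<bar> < \<delta>"
      using s(1) by (simp add: D_def T_def t dist_norm abs_minus_commute flip: of_real_diff)
    moreover have "Kquo a b t = k" using s(2) unfolding t of_real_quo by simp
    ultimately show False using max[of t] k by simp
  qed
  moreover have "(norm s)\<^sup>2 < norm (Rquo A B s)"
    using near[of s] s(1) by (simp add: D_def dist_commute)
  ultimately show ?thesis
    using dominant_pair_imp_nonreal_zero[of a b s k] s(2) k unfolding A_def B_def by blast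
qed

text \<open>At - 1 the square in the numerator of \<open>Kquo\<close> vanishes while the denominator
  is \<open>a < 0\<close>, so \<open>Kquo\<close> has a local maximum with value 0. There
  \<open>Rquo\<close> is \<open>a / (1 + b)\<close>, of modulus above 1 because
  \<open>1 + a + b < 0\<close>.\<close>

lemma nonreal_zero_if_a_small:
  fixes a b :: real
  assumes "b \<ge> 0" "1 + a + b < 0"
  shows "\<exists>m w. hrec (- 1) (of_real a - of_real b * w) (- w) m = (0 :: complex) \<and> w \<notin> \<real>"
proof -
  have "a < 0" "1 + b > 0" using assms by linarith+
  \<comment> \<open>\<open>\<delta> \<le> 1\<close> keeps \<open>t\<close> negative with
    \<open>\<bar>t\<bar> \<le> 2\<close>; then \<open>2 * \<delta> \<le> - a\<close> keeps the
    denominator nonpositive.\<close>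
  define \<delta> where "\<delta> = min (1 / (1 + b)) (- a / 2)"
  have \<delta>: "\<delta> > 0" "\<delta> \<le> 1" "\<delta> \<le> - a / 2"
    using \<open>a < 0\<close> assms(1) by (auto simp: \<delta>_def min_le_iff_disj divide_le_eq_1)
  have "Kquo a b t \<le> Kquo a b (- 1)" if t: "\<bar>t - (- 1)\<bar> < \<delta>" for t
  proof -
    have t': "t < 0" "- 1 - \<delta> < t" "t < - 1 + \<delta>" using t \<delta> by (simp_all add: abs_less_iff)
    have "t\<^sup>2 + t = t * (t + 1)" by (simp add: power2_eq_square algebra_simps)
    also have "\<dots> \<le> \<bar>t\<bar> * \<bar>t + 1\<bar>" by (metis abs_ge_self abs_mult)
    also have "\<dots> \<le> 2 * \<delta>" using t t' \<delta> by (intro mult_mono) auto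
    also have "\<dots> \<le> - a" using \<delta> by simp
    finally have "t\<^sup>2 + t + a \<le> 0" by simp
    moreover have "b * t \<le> 0" using t' assms(1) by (intro mult_nonneg_nonpos) auto
    hence "0 \<le> 1 - b * t" by simp
    ultimately have "Kquo a b t \<le> 0"
      unfolding Kquo_def by (intro divide_nonneg_nonpos mult_nonneg_nonneg) auto
    thus ?thesis by (simp add: Kquo_def)
  qed
  moreover have "(- 1)\<^sup>2 < \<bar>Rquo a b (- 1)\<bar>"
    using assms \<open>a < 0\<close> \<open>1 + b > 0\<close> by (simp add: Rquo_def abs_divide less_divide_eq divide_less_eq)
  ultimately show ?thesis
    using \<open>a < 0\<close> \<open>1 + b > 0\<close> \<delta>(1)
    by (intro real_local_max_imp_nonreal_zero[of b "- 1" a \<delta>]) (auto simp: Kquo_def)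
qed

text \<open>At the critical value \<open>a = 1 / 3 + b / 27\<close> a cubic of the family has the
  triple root \<open>- 1 / 3\<close>, where \<open>Kquo\<close> is 4. For larger \<open>a\<close> a
  local maximum with value below 4 appears to the right of \<open>- 1 / 3\<close>.\<close>

lemma nonreal_zero_if_a_large:
  fixes a b :: real
  assumes b: "b \<ge> 0" and a: "9 - 27 * a + b < 0"
  shows "\<exists>m w. hrec (- 1) (of_real a - of_real b * w) (- w) m = (0 :: complex) \<and> w \<notin> \<real>"
proof -
  have den: "t\<^sup>2 + t + a > 0" for t
  proof -
    have "t\<^sup>2 + t + a = (t + 1 / 2)\<^sup>2 + (a - 1 / 4)" by (simp add: power2_eq_square algebra_simps)
    moreover have "a > 1 / 4" using a b by linarith
    ultimately show ?thesis by (metis add_nonneg_pos diff_gt_0_iff_gt zero_le_power2)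
  qed
  have "\<exists>t0 \<delta>. - 1 / 3 < t0 \<and> b * t0 < 1 \<and> \<delta> > 0 \<and> (\<forall>t. \<bar>t - t0\<bar> < \<delta> \<longrightarrow> Kquo a b t \<le> Kquo a b t0)"
  proof (cases "b = 0")
    case True
    \<comment> \<open>Without the right endpoint \<open>1 / b\<close> there is no compact interval
      at hand; completing a square gives the global maximum, attained at
      \<open>2 * a - 1\<close>.\<close>
    have "Kquo a b t \<le> 4 * a / (4 * a - 1)" for t
    proof -
      have "4 * a * (t\<^sup>2 + t + a) - (4 * a - 1) * (1 + t)\<^sup>2 = (t - (2 * a - 1))\<^sup>2"
        by (simp add: power2_eq_square algebra_simps)
      hence "(4 * a - 1) * (1 + t)\<^sup>2 \<le> 4 * a * (t\<^sup>2 + t + a)"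
        by (metis diff_ge_0_iff_ge zero_le_power2)
      thus ?thesis using den[of t] a True by (simp add: Kquo_def field_simps)
    qed
    moreover have "Kquo a b (2 * a - 1) = 4 * a / (4 * a - 1)"
    proof -
      have "(1 + (2 * a - 1))\<^sup>2 = a * (4 * a)" "(2 * a - 1)\<^sup>2 + (2 * a - 1) + a = a * (4 * a - 1)"
        by (simp_all add: power2_eq_square algebra_simps)
      thus ?thesis using a True by (simp add: Kquo_def)
    qed
    ultimately show ?thesis using a True
      by - (rule exI[of _ "2 * a - 1"], rule exI[of _ "1 :: real"], auto)
  next
    case False
    hence b0: "b > 0" using b by simp
    define I where "I = {- 1 / 3..1 / b}"
    have "continuous_on I (Kquo a b)"
      unfolding Kquo_def[abs_def] using den by (intro continuous_intros) (metis less_irrefl)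
    moreover have ne: "- 1 / 3 \<in> I" "1 / b \<in> I" using b0 by (auto simp: I_def intro: order.trans[of _ 0])
    moreover have "compact I" by (simp add: I_def)
    ultimately obtain t0 where t0: "t0 \<in> I" "\<And>t. t \<in> I \<Longrightarrow> Kquo a b t \<le> Kquo a b t0"
      using continuous_attains_sup[of I "Kquo a b"] by blast
    define N D where "N t = (1 + t)\<^sup>2 * (1 - b * t)" and "D t = t\<^sup>2 + t + a" for t
    have dN: "(N has_real_derivative (1 + t) * (2 - b - 3 * b * t)) (at t)" for t
      unfolding N_def by (auto intro!: derivative_eq_intros simp: power2_eq_square algebra_simps)
    have dD: "(D has_real_derivative 2 * t + 1) (at t)" for t
      unfolding D_def by (auto intro!: derivative_eq_intros simp: power2_eq_square algebra_simps)
    \<comment> \<open>The numerator of this quotient-rule derivative equals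
      \<open>4 / 3 * (a - 1 / 3 - b / 27)\<close>, so it is positive and the maximum is not at the
      left end. At the right end \<open>Kquo\<close> is 0.\<close>
    define d where "d = ((1 + (- 1 / 3)) * (2 - b - 3 * b * (- 1 / 3)) * D (- 1 / 3) -
        N (- 1 / 3) * (2 * (- 1 / 3) + 1)) / (D (- 1 / 3) * D (- 1 / 3))"
    have "(Kquo a b has_real_derivative d) (at (- 1 / 3))"
      unfolding d_def using DERIV_divide[OF dN dD, of "- 1 / 3"] den[of "- 1 / 3"]
      by (simp add: Kquo_def[abs_def] N_def D_def)
    moreover have "d > 0"
      unfolding d_def using den[of "- 1 / 3"] a
      by (intro divide_pos_pos mult_pos_pos) (auto simp: N_def D_def power2_eq_square field_simps)
    ultimately obtain \<eta> where \<eta>: "\<eta> > 0"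
        "\<And>h. 0 < h \<Longrightarrow> h < \<eta> \<Longrightarrow> Kquo a b (- 1 / 3) < Kquo a b (- 1 / 3 + h)"
      using DERIV_pos_inc_right by blast
    define h where "h = min (\<eta> / 2) (1 / b)"
    have "0 < h" "h < \<eta>" "h \<le> 1 / b" using \<eta> b0 by (auto simp: h_def)
    hence "- 1 / 3 + h \<in> I" "Kquo a b (- 1 / 3) < Kquo a b (- 1 / 3 + h)"
      using \<eta> by (auto simp: I_def)
    hence "t0 \<noteq> - 1 / 3" using t0(2) by fastforce
    moreover have "Kquo a b (1 / b) < Kquo a b (- 1 / 3)"
      using b0 den[of "- 1 / 3"] by (simp add: Kquo_def)
    hence "t0 \<noteq> 1 / b" using t0(2)[OF ne(1)] by auto
    ultimately have t0': "- 1 / 3 < t0" "t0 < 1 / b" using t0(1) by (auto simp: I_def)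
    hence "b * t0 < 1" using b0 by (simp add: field_simps)
    moreover have "Kquo a b t \<le> Kquo a b t0" if "\<bar>t - t0\<bar> < min (t0 + 1 / 3) (1 / b - t0)" for t
      using that by (intro t0(2)) (auto simp: I_def abs_less_iff)
    ultimately show ?thesis
      using t0' by - (rule exI[of _ t0], rule exI[of _ "min (t0 + 1 / 3) (1 / b - t0)"], auto)
  qed
  then obtain t0 \<delta> where t0: "- 1 / 3 < t0" "b * t0 < 1" and \<delta>: "\<delta> > 0"
      "\<And>t. \<bar>t - t0\<bar> < \<delta> \<Longrightarrow> Kquo a b t \<le> Kquo a b t0" by blast
  have excess: "0 < a - 1 / 3 - b / 27" using a by linarith
  have "Kquo a b t0 < 4"
  proof -
    \<comment> \<open>Expansion around \<open>- 1 / 3\<close>, a double zero of the left side for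
      critical \<open>a\<close>, makes every term visibly nonnegative and the last one
      positive.\<close>
    have eq: "4 * (t0\<^sup>2 + t0 + a) - (1 + t0)\<^sup>2 * (1 - b * t0) =
      (t0 + 1 / 3)\<^sup>2 * (b * (t0 + 1 / 3) + b + 3) + 4 * (a - 1 / 3 - b / 27)"
      by (simp add: power2_eq_square algebra_simps)
    have "0 \<le> b * (t0 + 1 / 3)" using t0(1) b by (intro mult_nonneg_nonneg) auto
    hence "0 < 4 * (t0\<^sup>2 + t0 + a) - (1 + t0)\<^sup>2 * (1 - b * t0)"
      unfolding eq using b excess by (intro add_nonneg_pos mult_nonneg_nonneg) auto
    thus ?thesis using den[of t0] by (simp add: Kquo_def divide_less_eq)
  qed
  moreover have "t0\<^sup>2 < Rquo a b t0"
  proof -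
    \<comment> \<open>Again arranged around \<open>- 1 / 3\<close>, with the cofactor of
      \<open>b * (t0 + 1 / 3)\<close> written as a square plus a positive constant.\<close>
    have eq: "t0\<^sup>2 + t0 + a - t0\<^sup>2 * (1 - b * t0) =
      (t0 + 1 / 3) + b * ((t0 + 1 / 3) * ((t0 - 1 / 6)\<^sup>2 + 1 / 12)) + (a - 1 / 3 - b / 27)"
      by (simp add: power2_eq_square algebra_simps)
    have "0 \<le> t0 + 1 / 3" using t0(1) by simp
    moreover from this have "0 \<le> b * ((t0 + 1 / 3) * ((t0 - 1 / 6)\<^sup>2 + 1 / 12))"
      using b by simp
    ultimately have "0 < t0\<^sup>2 + t0 + a - t0\<^sup>2 * (1 - b * t0)"
      unfolding eq using excess by (intro add_nonneg_pos[OF add_nonneg_nonneg])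
    thus ?thesis using t0 by (simp add: Rquo_def less_divide_eq)
  qed
  moreover have "0 \<le> Kquo a b t0"
    unfolding Kquo_def using t0 den[of t0] by (intro divide_nonneg_pos mult_nonneg_nonneg) auto
  ultimately show ?thesis
    using t0 den[of t0] \<delta> by (intro real_local_max_imp_nonreal_zero[of b t0 a \<delta>]) auto
qed

section \<open>Normalisation and the equivalence\<close>

text \<open>With \<open>w = A(z) / c^3\<close> the quotient \<open>B(z) / c^2\<close> becomes
  \<open>a - b w\<close>, which is where \<open>a\<close> and \<open>b\<close> come from;
  homogeneity then takes out \<open>c ^ m\<close>.\<close>

lemma poly_map_Pseq_normalised:
  fixes c b0 b1 a0 a1 :: real and z :: complex
  assumes "c \<noteq> 0" "a1 \<noteq> 0"
  defines "a \<equiv> b0 / c\<^sup>2 - (b1 * a0) / (c\<^sup>2 * a1)" and "b \<equiv> - (b1 * c) / a1"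
    and "w \<equiv> (of_real a0 + of_real a1 * z) / of_real (c ^ 3)"
  shows "poly (map_poly complex_of_real (Pseq c [:b0, b1:] [:a0, a1:] m)) z =
           of_real (c ^ m) * hrec (- 1) (of_real a - of_real b * w) (- w) m"
proof -
  have "of_real c ^ 3 * (- w) = - (of_real a0 + of_real a1 * z)"
    using assms(1) by (simp add: w_def)
  moreover have "(of_real c)\<^sup>2 * (of_real a - of_real b * w) = of_real b0 + of_real b1 * z"
  proof -
    have "c\<^sup>2 * a = b0 - b1 / a1 * a0"
      using assms(1) by (simp add: a_def field_simps)
    hence "complex_of_real (c\<^sup>2 * a) = of_real (b0 - b1 / a1 * a0)" by (simp only:)
    hence ca: "(of_real c)\<^sup>2 * of_real a = of_real b0 - of_real (b1 / a1) * complex_of_real a0"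
      by (simp only: of_real_mult of_real_diff of_real_power)
    have cb: "(of_real c)\<^sup>2 * (of_real b * w) =
        - of_real (b1 / a1) * (of_real a0 + of_real a1 * z)"
      using assms(1,2) by (simp add: b_def w_def power2_eq_square power3_eq_cube)
    have "complex_of_real (b1 / a1) * of_real a1 = of_real b1" using assms(2) by simp
    thus ?thesis unfolding right_diff_distrib ca cb by (simp add: distrib_left mult.assoc[symmetric])
  qed
  ultimately show ?thesis
    using hrec_scale[of "of_real c" "- 1" "of_real a - of_real b * w" "- w" m]
    by (simp add: poly_map_Pseq map_poly_pCons algebra_simps)
qed

theorem theorem1:
  fixes c b0 b1 a0 a1 :: real
  assumes "c * a1 * b1 \<le> 0" and "c * a1 \<noteq> 0"
  defines "a \<equiv> b0 / c^2 - (b1 * a0) / (c^2 * a1)"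
      and "b \<equiv> - (b1 * c) / a1"
  shows "(\<forall>m::nat. all_zeros_real (Pseq c [:b0, b1:] [:a0, a1:] m))
         \<longleftrightarrow> (1 + a + b \<ge> 0 \<and> 9 - 27 * a + b \<ge> 0)"
proof -
  have ne: "c \<noteq> 0" "a1 \<noteq> 0" using assms(2) by auto
  \<comment> \<open>The sign hypothesis on \<open>c * a1 * b1\<close> enters only as
    \<open>b \<ge> 0\<close>.\<close>
  have "b = - (c * a1 * b1) / a1\<^sup>2" using ne by (simp add: b_def power2_eq_square)
  hence b: "b \<ge> 0" using assms(1) by (simp add: divide_nonpos_nonneg)
  define w where "w z = (of_real a0 + of_real a1 * z) / of_real (c ^ 3)" for z :: complex
  define Q where "Q m v = hrec (- 1) (of_real a - of_real b * v) (- v) m" for m and v :: complex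
  \<comment> \<open>\<open>w\<close> is an affine bijection with real coefficients, so reality of
    the zeros can be tested in the variable \<open>w\<close>.\<close>
  have w_real: "w z \<in> \<real> \<longleftrightarrow> z \<in> \<real>" for z
  proof
    assume "w z \<in> \<real>"
    moreover have "z = (of_real (c ^ 3) * w z - of_real a0) / of_real a1"
      using ne by (simp add: w_def)
    ultimately show "z \<in> \<real>" by (metis Reals_diff Reals_divide Reals_mult Reals_of_real)
  qed (auto simp: w_def)
  have w_surj: "\<exists>z. w z = v" for v
    using ne by (intro exI[of _ "(of_real (c ^ 3) * v - of_real a0) / of_real a1"]) (simp add: w_def)
  have "poly (map_poly complex_of_real (Pseq c [:b0, b1:] [:a0, a1:] m)) z = of_real (c ^ m) * Q m (w z)"
    for m z
    unfolding w_def a_def b_def Q_def by (rule poly_map_Pseq_normalised[OF ne])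
  hence zeros: "all_zeros_real (Pseq c [:b0, b1:] [:a0, a1:] m) \<longleftrightarrow> (\<forall>v. Q m v = 0 \<longrightarrow> v \<in> \<real>)" for m
    unfolding all_zeros_real_def using ne(1) w_real w_surj by (auto; metis)
  show ?thesis
  proof
    assume "\<forall>m. all_zeros_real (Pseq c [:b0, b1:] [:a0, a1:] m)"
    hence "\<nexists>m v. Q m v = 0 \<and> v \<notin> \<real>" using zeros by blast
    thus "1 + a + b \<ge> 0 \<and> 9 - 27 * a + b \<ge> 0"
      using nonreal_zero_if_a_small[OF b, of a] nonreal_zero_if_a_large[OF b, of a]
      unfolding Q_def by (meson not_le)
  next
    assume "1 + a + b \<ge> 0 \<and> 9 - 27 * a + b \<ge> 0"
    then obtain r0 where "real_rooted_regime a b r0"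
      using real_rooted_regime_exists[OF b, of a] by blast
    \<comment> \<open>This polynomial is the case \<open>c = 1\<close>, \<open>A(v) = v\<close>, in
      which the change of variable is trivial and the values are those of
      \<open>Q m\<close>.\<close>
    hence "all_zeros_real (Pseq 1 [:a, - b:] [:0, 1:] m)" for m
      by (rule real_rooted_regime.all_zeros_real_Pseq)
    hence "Q m v = 0 \<Longrightarrow> v \<in> \<real>" for m v
      unfolding all_zeros_real_def poly_map_Pseq Q_def by (simp add: map_poly_pCons mult.commute)
    thus "\<forall>m. all_zeros_real (Pseq c [:b0, b1:] [:a0, a1:] m)" using zeros by blast
  qed
qed

end
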